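(* Let $s\in\mathrm{Spin}(m)$, i.e. $s=\underline\omega_1\cdots\underline\omega_{2k}$ with $\underline\omega_i\in S^{m-1}$ unit vectors. Let $f$ be a discrete monogenic function in $\xi_1,\dots,\xi_m$, i.e. $\partial f=0$. Then $$\partial\big(s\,f(\bar s\,\xi\,s)\big)=\partial\big(\underline\omega_1\cdots\underline\omega_{2k}\,f(\overline{\underline\omega_{2k}}\cdots\overline{\underline\omega_1}\,\xi\,\underline\omega_1\cdots\underline\omega_{2k})\big)=0.$$
   Context: Clifford algebra: $\mathbb{C}_{2m,0}$ is the complex Clifford algebra generated by $\mathbf{e}_j^{\pm}$, $j=1,\dots,m$, with $\{\mathbf{e}_j^+,\mathbf{e}_k^+\}=\{\mathbf{e}_j^-,\mathbf{e}_k^-\}=0$, $\{\mathbf{e}_j^+,\mathbf{e}_k^-\}=\delta_{jk}$ ($\{a,b\}=ab+ba$); $e_j=\mathbf{e}_j^++\mathbf{e}_j^-$. Discrete functions are functions $f:\mathbb{Z}^m\to\mathbb{C}_{2m,0}$. With $\Delta_j^+f(x)=f(x+e_j)-f(x)$, $\Delta_j^-f(x)=f(x)-f(x-e_j)$ (in the argument $e_j$ denotes the $j$-th unit lattice vector), put $\partial_j=\mathbf{e}_j^+\Delta_j^++\mathbf{e}_j^-\Delta_j^-$, $\partial=\sum_j\partial_j$ (discrete Dirac operator). Basic polynomials: for $\alpha\in\mathbb{N}^m$, $\xi^\alpha[1]=\xi_1^{\alpha_1}\cdots\xi_m^{\alpha_m}[1]$ is the discrete function determined by $\xi^0[1]=1$,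 $\partial_j\,\xi^\alpha[1]=(-1)^{\alpha_1+\dots+\alpha_{j-1}}\alpha_j\,\xi^{\alpha-\epsilon_j}[1]$ ($\epsilon_j$ the $j$-th unit multi-index) and $\xi^\alpha[1](0)=0$ for $\alpha\ne0$; one has $\xi^\alpha[1](x)=0$ as soon as some $\alpha_j\ge 2|x_j|+1$. Every discrete function has a unique, pointwise finite Taylor expansion $f=\sum_\alpha\xi^\alpha[1]\,c_\alpha$, $c_\alpha\in\mathbb{C}_{2m,0}$; discrete polynomials are finite such sums. The right $\mathbb{C}_{2m,0}$-linear operators $\xi_j,R_j$ (extended termwise to Taylor series) are given by $\xi_j(\xi^\alpha[1])=(-1)^{\alpha_1+\dots+\alpha_{j-1}}\xi^{\alpha+\epsilon_j}[1]$ and $R_j(\xi^\alpha[1])=(-1)^{|\alpha|-\alpha_j}\xi^\alpha[1]\,e_j$. They satisfy $\{\xi_j,\xi_k\}=\{\partial_j,\partial_k\}=\{\partial_j,\xi_k\}=0$ ($j\neq k$), $\partial_j\xi_j-\xi_j\partial_j=1$, $\{R_j,R_k\}=2\delta_{jk}$, $R_j[1]=e_j$, $\{R_j,\xi_k\}=2R_j\xi_j\delta_{jk}$, $\{R_j,\partial_k\}=2R_j\partial_j\delta_{jk}$. Put $\xi=\sum_j\xi_j$ and $\langle X,Y\rangle=\frac12(XY+YX)$ for operators $X,Y$. Spin group: $\mathbb{R}^1_m=\{\sum_j\omega_jR_j:\omega_j\in\mathbb{R}\}$, $S^{m-1}=\{\underline\omega\in\mathbb{R}^1_m:\underline\omega^2=1\}$;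 $\mathrm{Spin}(m)$ is the group of products of an even number of elements of $S^{m-1}$. The conjugation satisfies $\overline{R_j}=-R_j$, $\overline{ab}=\bar b\,\bar a$. Substitution: let $\eta=\bar s\,\xi\,s$ and $\eta_j=\langle\eta,R_j\rangle R_j$, so $\eta=\sum_j\eta_j$. For $f=\sum_\alpha\xi^\alpha[1]c_\alpha$, $f(\bar s\,\xi\,s)=\sum_\alpha\eta_1^{\alpha_1}\cdots\eta_m^{\alpha_m}[1]\,c_\alpha$; $s$ acts on this function as an operator. *)

theory Defs
  imports Complex_Main "HOL-Library.Poly_Mapping"
begin

section \<open>The complex Clifford algebra on a Witt basis\<close>

text \<open>
  The dimension \<open>m\<close> is the cardinality of a finite, linearly ordered index type \<open>'n\<close>, which plays
  the role of \<open>{1,\<dots>,m}\<close>. The Clifford algebra is the unital associative complex algebra given by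
  the generators \<open>e_j^+\<close>, \<open>e_j^-\<close> and their anticommutation relations, that is, the free algebra on
  these generators modulo the two-sided ideal generated by the relations.
\<close>

datatype 'n witt = Plus 'n | Minus 'n

datatype 'a free_mon = Mon (letters: "'a list")

text \<open>The monoid of words is written additively, as this is what \<^type>\<open>poly_mapping\<close> expects.\<close>

instantiation free_mon :: (type) monoid_add
begin
definition "0 = Mon []"
definition "u + v = Mon (letters u @ letters v)"
instance by standard (auto simp: zero_free_mon_def plus_free_mon_def)
end

type_synonym 'n free_alg = "'n witt free_mon \<Rightarrow>\<^sub>0 complex"

definition gen :: "'n witt \<Rightarrow> 'n free_alg" where
  "gen a = Poly_Mapping.single (Mon [a]) 1"

inductive_set witt_relators :: "'n free_alg set" where
  "gen (Plus j) * gen (Plus k) + gen (Plus k) * gen (Plus j) \<in> witt_relators"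
| "gen (Minus j) * gen (Minus k) + gen (Minus k) * gen (Minus j) \<in> witt_relators"
| "gen (Plus j) * gen (Minus k) + gen (Minus k) * gen (Plus j) - (if j = k then 1 else 0)
     \<in> witt_relators"

inductive_set witt_ideal :: "'n free_alg set" where
  zero: "0 \<in> witt_ideal"
| relator: "r \<in> witt_relators \<Longrightarrow> r \<in> witt_ideal"
| add: "p \<in> witt_ideal \<Longrightarrow> q \<in> witt_ideal \<Longrightarrow> p + q \<in> witt_ideal"
| mult_left: "p \<in> witt_ideal \<Longrightarrow> a * p \<in> witt_ideal"
| mult_right: "p \<in> witt_ideal \<Longrightarrow> p * a \<in> witt_ideal"

lemma witt_ideal_uminus: "p \<in> witt_ideal \<Longrightarrow> - p \<in> witt_ideal"
  using witt_ideal.mult_left[of p "- 1"] by simp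

definition witt_equiv :: "'n free_alg \<Rightarrow> 'n free_alg \<Rightarrow> bool" where
  "witt_equiv p q \<longleftrightarrow> p - q \<in> witt_ideal"

lemma equivp_witt_equiv: "equivp witt_equiv"
proof (rule equivpI)
  show "reflp witt_equiv" by (simp add: reflp_def witt_equiv_def witt_ideal.zero)
  show "symp witt_equiv"
    by (metis minus_diff_eq sympI witt_equiv_def witt_ideal_uminus)
  show "transp witt_equiv"
  proof (rule transpI)
    fix p q r :: "'n free_alg" assume "witt_equiv p q" "witt_equiv q r"
    then show "witt_equiv p r"
      using witt_ideal.add[of "p - q" "q - r"] by (simp add: witt_equiv_def)
  qed
qed

quotient_type 'n clifford = "'n free_alg" / witt_equiv
  by (rule equivp_witt_equiv)

text \<open>
  The ring axioms include \<open>0 \<noteq> 1\<close>; to verify it, the free algebra is represented by creation and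
  annihilation operators on the fermionic Fock space.
\<close>

definition fock_sign :: "'n::{finite,linorder} \<Rightarrow> 'n set \<Rightarrow> complex" where
  "fock_sign j A = (\<Prod>i\<in>A. if i < j then - 1 else 1)"

fun fock_gen ::
  "'n::{finite,linorder} witt \<Rightarrow> ('n set \<Rightarrow> complex) \<Rightarrow> 'n set \<Rightarrow> complex" where
  "fock_gen (Plus j) g A = (if j \<in> A then fock_sign j (A - {j}) * g (A - {j}) else 0)"
| "fock_gen (Minus j) g A = (if j \<in> A then 0 else fock_sign j A * g (insert j A))"

definition fock_word ::
  "'n::{finite,linorder} witt free_mon \<Rightarrow> ('n set \<Rightarrow> complex) \<Rightarrow> 'n set \<Rightarrow> complex" where
  "fock_word w g = foldr fock_gen (letters w) g"

definition fock ::
  "'n::{finite,linorder} free_alg \<Rightarrow> ('n set \<Rightarrow> complex) \<Rightarrow> 'n set \<Rightarrow> complex" where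
  "fock p g A = (\<Sum>w\<in>Poly_Mapping.keys p. Poly_Mapping.lookup p w * fock_word w g A)"

lemma fock_sign_insert:
  "k \<notin> A \<Longrightarrow> fock_sign j (insert k A) = (if k < j then - 1 else 1) * fock_sign j A"
  by (simp add: fock_sign_def)

lemma fock_sign_square: "fock_sign j A * fock_sign j A = 1"
  by (simp add: fock_sign_def flip: prod.distrib) (rule prod.neutral, simp)

lemma fock_gen_add: "fock_gen a (\<lambda>A. g A + h A) = (\<lambda>A. fock_gen a g A + fock_gen a h A)"
  by (cases a) (auto simp: fun_eq_iff algebra_simps)

lemma fock_gen_scale: "fock_gen a (\<lambda>A. c * g A) = (\<lambda>A. c * fock_gen a g A)"
  by (cases a) (auto simp: fun_eq_iff)

lemma fock_word_add: "fock_word w (\<lambda>A. g A + h A) = (\<lambda>A. fock_word w g A + fock_word w h A)"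
proof -
  have "foldr fock_gen l (\<lambda>A. g A + h A)
      = (\<lambda>A. foldr fock_gen l g A + foldr fock_gen l h A)" for l
    by (induction l) (simp_all add: fock_gen_add)
  then show ?thesis by (simp add: fock_word_def)
qed

lemma fock_word_scale: "fock_word w (\<lambda>A. c * g A) = (\<lambda>A. c * fock_word w g A)"
proof -
  have "foldr fock_gen l (\<lambda>A. c * g A) = (\<lambda>A. c * foldr fock_gen l g A)" for l
    by (induction l) (simp_all add: fock_gen_scale)
  then show ?thesis by (simp add: fock_word_def)
qed

lemma fock_word_plus: "fock_word (u + v) g = fock_word u (fock_word v g)"
  by (simp add: fock_word_def plus_free_mon_def)

lemma fock_superset:
  "finite S \<Longrightarrow> Poly_Mapping.keys p \<subseteq> S \<Longrightarrow> fock p g A = (\<Sum>w\<in>S. Poly_Mapping.lookup p w * fock_word w g A)"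
  unfolding fock_def by (rule sum.mono_neutral_left) (auto simp: in_keys_iff)

lemma fock_add_left: "fock (p + q) g A = fock p g A + fock q g A"
proof -
  let ?S = "Poly_Mapping.keys p \<union> Poly_Mapping.keys q"
  have "fock r g A = (\<Sum>w\<in>?S. Poly_Mapping.lookup r w * fock_word w g A)" if "Poly_Mapping.keys r \<subseteq> ?S" for r
    using that by (intro fock_superset) auto
  then show ?thesis
    using Poly_Mapping.keys_add[of p q]
    by (simp add: lookup_add algebra_simps sum.distrib)
qed

lemma fock_single: "fock (Poly_Mapping.single w c) g A = c * fock_word w g A"
  by (cases "c = 0") (auto simp: fock_def)

lemma fock_zero: "fock 0 g A = 0"
  by (simp add: fock_def)

lemma fock_add_right: "fock p (\<lambda>A. g A + h A) = (\<lambda>A. fock p g A + fock p h A)"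
  by (simp add: fun_eq_iff fock_def fock_word_add algebra_simps sum.distrib)

lemma fock_scale_right: "fock p (\<lambda>A. c * g A) = (\<lambda>A. c * fock p g A)"
  by (simp add: fun_eq_iff fock_def fock_word_scale sum_distrib_left algebra_simps)

lemma free_alg_induct [case_names single add]:
  fixes p :: "'n free_alg"
  assumes "\<And>w c. P (Poly_Mapping.single w c)" "\<And>p q. P p \<Longrightarrow> P q \<Longrightarrow> P (p + q)"
  shows "P p"
proof (induction p rule: Poly_Mapping.update_induct)
  case const
  show ?case using assms(1)[of undefined 0] by simp
next
  case (update f a b)
  have "Poly_Mapping.update a b f = Poly_Mapping.single a b + f"
    using update.hyps
    by (intro poly_mapping_eqI) (auto simp: lookup_add lookup_single lookup_update in_keys_iff when_def)
  with update show ?case by (simp add: assms)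
qed

lemma fock_mult: "fock (p * q) g = fock p (fock q g)"
proof (induction p rule: free_alg_induct)
  case (single u c)
  show ?case
  proof (induction q rule: free_alg_induct)
    case (single v d)
    then show ?case
      by (simp add: fun_eq_iff mult_single fock_single fock_word_plus)
         (metis fock_word_scale[of u d "fock_word v g"] fock_single ext)
  next
    case (add q r)
    have "fock (q + r) g = (\<lambda>A. fock q g A + fock r g A)" by (simp add: fun_eq_iff fock_add_left)
    with add show ?case
      by (simp add: fun_eq_iff distrib_left fock_add_left fock_add_right)
  qed
next
  case (add p r)
  then show ?case by (simp add: fun_eq_iff distrib_right fock_add_left)
qed

lemma fock_diff: "fock (p - q) g A = fock p g A - fock q g A"
  using fock_add_left[of "p - q" q g A] by simp

lemma fock_one: "fock 1 g = g"
proof -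
  have "fock (Poly_Mapping.single 0 1) g = g"
    by (simp only: fun_eq_iff fock_single) (simp add: fock_word_def zero_free_mon_def)
  then show ?thesis by (simp only: single_one)
qed

lemma fock_gen: "fock (gen a) g = fock_gen a g"
  by (simp add: fun_eq_iff gen_def fock_single fock_word_def)

lemma fock_relator:
  assumes "r \<in> witt_relators"
  shows "fock r g A = 0"
  using assms
proof cases
  case (1 j k)
  show ?thesis
  proof (cases "j \<noteq> k \<and> j \<in> A \<and> k \<in> A")
    case True
    define B where "B = A - {j} - {k}"
    have B: "j \<notin> B" "k \<notin> B" "A - {j} = insert k B" "A - {k} = insert j B"
      "insert k B - {k} = B" "insert j B - {j} = B"
      using True by (auto simp: B_def)
    have "fock r g A = fock_sign j (insert k B) * (fock_sign k B * g B)
        + fock_sign k (insert j B) * (fock_sign j B * g B)"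
      using True by (simp add: 1 fock_add_left fock_mult fock_gen B)
    also have "\<dots> = 0"
      using True fock_sign_insert[OF B(1), of k] fock_sign_insert[OF B(2), of j]
      by (cases j k rule: linorder_cases) (auto simp: less_not_sym)
    finally show ?thesis .
  next
    case False
    then show ?thesis by (auto simp: 1 fock_add_left fock_mult fock_gen)
  qed
next
  case (2 j k)
  show ?thesis
  proof (cases "j \<noteq> k \<and> j \<notin> A \<and> k \<notin> A")
    case True
    have "fock r g A = fock_sign j A * (fock_sign k (insert j A) * g (insert j (insert k A)))
        + fock_sign k A * (fock_sign j (insert k A) * g (insert j (insert k A)))"
      using True by (auto simp: 2 fock_add_left fock_mult fock_gen insert_commute[of k j])
    also have "\<dots> = 0"
      using True fock_sign_insert[of j A k] fock_sign_insert[of k A j]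
      by (cases j k rule: linorder_cases) (auto simp: less_not_sym)
    finally show ?thesis .
  next
    case False
    then show ?thesis by (auto simp: 2 fock_add_left fock_mult fock_gen)
  qed
next
  case (3 j k)
  show ?thesis
  proof (cases "j = k")
    case True
    have sq: "fock_sign k B * (fock_sign k B * x) = x" for B x
      by (simp add: fock_sign_square flip: mult.assoc)
    show ?thesis
      using True
      by (cases "k \<in> A")
        (simp_all add: 3 fock_diff fock_add_left fock_mult fock_gen fock_one insert_absorb sq)
  next
    case neq: False
    show ?thesis
    proof (cases "j \<in> A \<and> k \<notin> A")
      case True
      define B where "B = A - {j}"
      have B: "j \<notin> B" "k \<notin> B" "A = insert j B" "insert k (insert j B) - {j} = insert k B"
        "insert j B - {j} = B" "j \<notin> insert k B"
        using True neq by (auto simp: B_def)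
      have "fock r g A = fock_sign j B * (fock_sign k B * g (insert k B))
          + fock_sign k (insert j B) * (fock_sign j (insert k B) * g (insert k B))"
        using neq B by (simp add: 3 fock_diff fock_add_left fock_mult fock_gen fock_zero)
      also have "\<dots> = 0"
        using neq fock_sign_insert[OF B(1), of k] fock_sign_insert[OF B(2), of j]
        by (cases j k rule: linorder_cases) (auto simp: less_not_sym)
      finally show ?thesis .
    next
      case False
      then show ?thesis
        using neq by (auto simp: 3 fock_diff fock_add_left fock_mult fock_gen fock_zero)
    qed
  qed
qed

lemma fock_ideal: "p \<in> witt_ideal \<Longrightarrow> fock p g = (\<lambda>A. 0)"
proof (induction arbitrary: g rule: witt_ideal.induct)
  case (mult_left p a)
  have "fock a (\<lambda>A. 0) = (\<lambda>A. 0)" using fock_scale_right[of a 0 "\<lambda>A. 0"] by simp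
  with mult_left show ?case by (simp add: fock_mult)
qed (auto simp: fun_eq_iff fock_zero fock_relator fock_add_left fock_mult)

lemma one_notin_witt_ideal: "(1 :: 'n::{finite,linorder} free_alg) \<notin> witt_ideal"
  using fock_ideal[of "1 :: 'n free_alg" "\<lambda>A. 1"] by (auto simp: fock_one fun_eq_iff)

lemma witt_equiv_add:
  assumes "witt_equiv p p'" "witt_equiv q q'"
  shows "witt_equiv (p + q) (p' + q')"
proof -
  have "p + q - (p' + q') = (p - p') + (q - q')" by simp
  then show ?thesis using assms by (simp only: witt_equiv_def witt_ideal.add)
qed

lemma witt_equiv_uminus:
  assumes "witt_equiv p p'"
  shows "witt_equiv (- p) (- p')"
proof -
  have "- p - - p' = - (p - p')" by simp
  then show ?thesis using assms by (simp only: witt_equiv_def witt_ideal_uminus)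
qed

lemma witt_equiv_diff:
  assumes "witt_equiv p p'" "witt_equiv q q'"
  shows "witt_equiv (p - q) (p' - q')"
  using witt_equiv_add[OF assms(1) witt_equiv_uminus[OF assms(2)]] by simp

lemma witt_equiv_mult:
  assumes "witt_equiv p p'" "witt_equiv q q'"
  shows "witt_equiv (p * q) (p' * q')"
proof -
  have "p * q - p' * q' = (p - p') * q + p' * (q - q')"
    by (simp add: left_diff_distrib right_diff_distrib)
  then show ?thesis
    using assms
    by (simp only: witt_equiv_def witt_ideal.add witt_ideal.mult_left witt_ideal.mult_right)
qed

instantiation clifford :: ("{finite,linorder}") ring_1
begin

lift_definition zero_clifford :: "'a clifford" is 0 .
lift_definition one_clifford :: "'a clifford" is 1 .
lift_definition plus_clifford :: "'a clifford \<Rightarrow> 'a clifford \<Rightarrow> 'a clifford" is "(+)"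
  by (rule witt_equiv_add)
lift_definition minus_clifford :: "'a clifford \<Rightarrow> 'a clifford \<Rightarrow> 'a clifford" is "(-)"
  by (rule witt_equiv_diff)
lift_definition uminus_clifford :: "'a clifford \<Rightarrow> 'a clifford" is uminus
  by (rule witt_equiv_uminus)
lift_definition times_clifford :: "'a clifford \<Rightarrow> 'a clifford \<Rightarrow> 'a clifford" is "(*)"
  by (rule witt_equiv_mult)

instance
proof
  fix a b c :: "'a clifford"
  show "a + b + c = a + (b + c)" by transfer (simp add: witt_equiv_def witt_ideal.zero add.assoc)
  show "a + b = b + a" by transfer (simp add: witt_equiv_def witt_ideal.zero add.commute)
  show "0 + a = a" by transfer (simp add: witt_equiv_def witt_ideal.zero)
  show "- a + a = 0" by transfer (simp add: witt_equiv_def witt_ideal.zero)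
  show "a - b = a + - b" by transfer (simp add: witt_equiv_def witt_ideal.zero)
  show "a * b * c = a * (b * c)" by transfer (simp add: witt_equiv_def witt_ideal.zero mult.assoc)
  show "1 * a = a" by transfer (simp add: witt_equiv_def witt_ideal.zero)
  show "a * 1 = a" by transfer (simp add: witt_equiv_def witt_ideal.zero)
  show "(a + b) * c = a * c + b * c"
    by transfer (simp add: witt_equiv_def witt_ideal.zero distrib_right)
  show "a * (b + c) = a * b + a * c"
    by transfer (simp add: witt_equiv_def witt_ideal.zero distrib_left)
  show "(0 :: 'a clifford) \<noteq> 1"
    unfolding zero_clifford_def one_clifford_def clifford.abs_eq_iff witt_equiv_def
    using one_notin_witt_ideal[where 'n = 'a] witt_ideal_uminus[of "- 1 :: 'a free_alg"] by auto
qed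

end

lift_definition clifford_of_complex :: "complex \<Rightarrow> 'n clifford" is
  "\<lambda>c. Poly_Mapping.single 0 c" .

lift_definition e_plus :: "'n \<Rightarrow> 'n clifford" is "\<lambda>j. gen (Plus j)" .
lift_definition e_minus :: "'n \<Rightarrow> 'n clifford" is "\<lambda>j. gen (Minus j)" .

definition e_vec :: "'n::{finite,linorder} \<Rightarrow> 'n clifford" where
  "e_vec j = e_plus j + e_minus j"

lemma witt_relations:
  fixes j k :: "'n::{finite,linorder}"
  shows "e_plus j * e_plus k + e_plus k * e_plus j = 0"
    and "e_minus j * e_minus k + e_minus k * e_minus j = 0"
    and "e_plus j * e_minus k + e_minus k * e_plus j = (if j = k then 1 else 0)"
  by (transfer, simp only: witt_equiv_def diff_zero, intro witt_ideal.relator witt_relators.intros)+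

lemma clifford_of_complex_hom:
  "clifford_of_complex (c + d)
     = (clifford_of_complex c + clifford_of_complex d :: 'n::{finite,linorder} clifford)"
  "clifford_of_complex (c * d)
     = (clifford_of_complex c * clifford_of_complex d :: 'n::{finite,linorder} clifford)"
  "clifford_of_complex 1 = (1 :: 'n::{finite,linorder} clifford)"
  by (transfer, simp add: single_add mult_single witt_equiv_def witt_ideal.zero)+

lemma single_zero_commute:
  fixes p :: "'n free_alg"
  shows "p * Poly_Mapping.single 0 c = Poly_Mapping.single 0 c * p"
  by (induction p rule: free_alg_induct)
     (simp_all add: mult_single mult.commute distrib_left distrib_right)

lemma clifford_of_complex_central:
  fixes a :: "'n::{finite,linorder} clifford"
  shows "a * clifford_of_complex c = clifford_of_complex c * a"
  by transfer (simp add: single_zero_commute witt_equiv_def witt_ideal.zero)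

instantiation clifford :: ("{finite,linorder}") real_algebra_1
begin

definition scaleR_clifford :: "real \<Rightarrow> 'a clifford \<Rightarrow> 'a clifford" where
  "scaleR_clifford r a = clifford_of_complex (of_real r) * a"

instance
proof
  fix r t :: real and a b :: "'a clifford"
  show "r *\<^sub>R (a + b) = r *\<^sub>R a + r *\<^sub>R b"
    by (simp add: scaleR_clifford_def distrib_left)
  show "(r + t) *\<^sub>R a = r *\<^sub>R a + t *\<^sub>R a"
    by (simp add: scaleR_clifford_def clifford_of_complex_hom distrib_right)
  show "r *\<^sub>R t *\<^sub>R a = (r * t) *\<^sub>R a"
    by (simp add: scaleR_clifford_def clifford_of_complex_hom mult.assoc)
  show "1 *\<^sub>R a = a"
    by (simp add: scaleR_clifford_def clifford_of_complex_hom)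
  show "r *\<^sub>R a * b = r *\<^sub>R (a * b)"
    by (simp add: scaleR_clifford_def mult.assoc)
  show "a * r *\<^sub>R b = r *\<^sub>R (a * b)"
    unfolding scaleR_clifford_def by (metis mult.assoc clifford_of_complex_central)
qed

end


section \<open>Discrete functions and the discrete Dirac operator\<close>

type_synonym 'n lattice = "'n \<Rightarrow> int"
type_synonym 'n dfun = "'n lattice \<Rightarrow> 'n clifford"
type_synonym 'n dop = "'n dfun \<Rightarrow> 'n dfun"
type_synonym 'n mindex = "'n \<Rightarrow> nat"

definition fwd_diff :: "'n::{finite,linorder} \<Rightarrow> 'n dop" where
  "fwd_diff j f x = f (x(j := x j + 1)) - f x"

definition bwd_diff :: "'n::{finite,linorder} \<Rightarrow> 'n dop" where
  "bwd_diff j f x = f x - f (x(j := x j - 1))"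

definition partial :: "'n::{finite,linorder} \<Rightarrow> 'n dop" where
  "partial j f x = e_plus j * fwd_diff j f x + e_minus j * bwd_diff j f x"

definition dirac :: "'n::{finite,linorder} dop" where
  "dirac f x = (\<Sum>j\<in>UNIV. partial j f x)"


section \<open>Basic polynomials and Taylor series\<close>

definition is_basic_family :: "('n::{finite,linorder} mindex \<Rightarrow> 'n dfun) \<Rightarrow> bool" where
  "is_basic_family p \<longleftrightarrow>
     p (\<lambda>_. 0) = (\<lambda>_. 1) \<and>
     (\<forall>\<alpha> j. partial j (p \<alpha>) =
        (\<lambda>x. (- 1) ^ (\<Sum>i<j. \<alpha> i) * of_nat (\<alpha> j) * p (\<alpha>(j := \<alpha> j - 1)) x)) \<and>
     (\<forall>\<alpha>. \<alpha> \<noteq> (\<lambda>_. 0) \<longrightarrow> p \<alpha> (\<lambda>_. 0) = 0)"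

definition basic_poly :: "'n::{finite,linorder} mindex \<Rightarrow> 'n dfun" where
  "basic_poly = (THE p. is_basic_family p)"

text \<open>
  \<^const>\<open>Sum_any\<close> sums over the support, so this is the value of a pointwise finite series.
  The series below are pointwise finite: \<open>\<xi>^\<alpha>[1](x)\<close> vanishes once some \<open>\<alpha>_j \<ge> 2|x_j| + 1\<close>.
\<close>

definition series :: "('n::{finite,linorder} mindex \<Rightarrow> 'n dfun) \<Rightarrow> 'n dfun" where
  "series T x = Sum_any (\<lambda>\<alpha>. T \<alpha> x)"

definition taylor_coeff :: "'n::{finite,linorder} dfun \<Rightarrow> 'n mindex \<Rightarrow> 'n clifford" where
  "taylor_coeff f = (THE c. f = series (\<lambda>\<alpha> x. basic_poly \<alpha> x * c \<alpha>))"


section \<open>The operators \<open>\<xi>_j\<close> and \<open>R_j\<close>\<close>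

definition xi :: "'n::{finite,linorder} \<Rightarrow> 'n dop" where
  "xi j f = series (\<lambda>\<alpha> x.
     (- 1) ^ (\<Sum>i<j. \<alpha> i) * basic_poly (\<alpha>(j := \<alpha> j + 1)) x * taylor_coeff f \<alpha>)"

definition R_op :: "'n::{finite,linorder} \<Rightarrow> 'n dop" where
  "R_op j f = series (\<lambda>\<alpha> x.
     (- 1) ^ (\<Sum>i\<in>UNIV - {j}. \<alpha> i) * basic_poly \<alpha> x * e_vec j * taylor_coeff f \<alpha>)"

definition xi_total :: "'n::{finite,linorder} dop" where
  "xi_total f x = (\<Sum>j\<in>UNIV. xi j f x)"

definition op_bracket :: "'n::{finite,linorder} dop \<Rightarrow> 'n dop \<Rightarrow> 'n dop" where
  "op_bracket X Y f x = (1 / 2) *\<^sub>R (X (Y f) x + Y (X f) x)"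


section \<open>The spin group\<close>

definition R_vec :: "('n::{finite,linorder} \<Rightarrow> real) \<Rightarrow> 'n dop" where
  "R_vec w f x = (\<Sum>j\<in>UNIV. w j *\<^sub>R R_op j f x)"

definition R1 :: "'n::{finite,linorder} dop set" where
  "R1 = range R_vec"

definition unit_vectors :: "'n::{finite,linorder} dop set" where
  "unit_vectors = {w \<in> R1. w \<circ> w = id}"

definition op_prod :: "'n::{finite,linorder} dop list \<Rightarrow> 'n dop" where
  "op_prod ws = foldr (\<circ>) ws id"

definition Spin :: "'n::{finite,linorder} dop set" where
  "Spin = {op_prod ws | ws. set ws \<subseteq> unit_vectors \<and> even (length ws)}"

text \<open>
  The graph of the conjugation, i.e. of the real-linear anti-automorphism \<open>R_j \<mapsto> - R_j\<close> of the
  algebra of operators generated over the reals by the \<open>R_j\<close>.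
\<close>

inductive conj_graph :: "'n::{finite,linorder} dop \<Rightarrow> 'n dop \<Rightarrow> bool" where
  "conj_graph id id"
| "conj_graph (R_op j) (\<lambda>f x. - R_op j f x)"
| "conj_graph a a' \<Longrightarrow> conj_graph (\<lambda>f x. c *\<^sub>R a f x) (\<lambda>f x. c *\<^sub>R a' f x)"
| "conj_graph a a' \<Longrightarrow> conj_graph b b' \<Longrightarrow> conj_graph (\<lambda>f x. a f x + b f x) (\<lambda>f x. a' f x + b' f x)"
| "conj_graph a a' \<Longrightarrow> conj_graph b b' \<Longrightarrow> conj_graph (a \<circ> b) (b' \<circ> a')"

definition op_conj :: "'n::{finite,linorder} dop \<Rightarrow> 'n dop" where
  "op_conj a = (THE b. conj_graph a b)"


section \<open>Substitution\<close>

definition op_component :: "'n::{finite,linorder} dop \<Rightarrow> 'n \<Rightarrow> 'n dop" where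
  "op_component \<eta> j = op_bracket \<eta> (R_op j) \<circ> R_op j"

text \<open>The ordered product \<open>\<eta>_1^{\<alpha>_1} \<dots> \<eta>_m^{\<alpha>_m}\<close> applied to the constant function \<open>1\<close>.\<close>

definition op_monomial :: "'n::{finite,linorder} dop \<Rightarrow> 'n mindex \<Rightarrow> 'n dfun" where
  "op_monomial \<eta> \<alpha> =
     op_prod (map (\<lambda>j. op_component \<eta> j ^^ \<alpha> j) (sorted_list_of_set UNIV)) (\<lambda>_. 1)"

definition op_subst :: "'n::{finite,linorder} dfun \<Rightarrow> 'n dop \<Rightarrow> 'n dfun" where
  "op_subst f \<eta> = series (\<lambda>\<alpha> x. op_monomial \<eta> \<alpha> x * taylor_coeff f \<alpha>)"

end

(* The operators X_k = xi_k R_k and D_k = partial_k R_k commute with all R_j and satisfy the Weyl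
   relations, so in these variables the discrete Dirac operator is the classical one,
   partial = sum_k D_k R_k and xi = sum_k X_k R_k.  Conjugation by s in Spin(m) acts on the R_k by a
   rotation M; hence, with the rotated variables Y_j = sum_k M_kj X_k and E_j = sum_k M_kj D_k,
   conj(s) xi s = sum_j Y_j R_j  and  conj(s) partial s = sum_j E_j R_j,
   and the components Y_j R_j, E_j R_j satisfy the same relations as xi_j, partial_j.  Substitution
   therefore intertwines partial with conj(s) partial s.  Everything is checked on basic polynomials,
   which suffices because all operators involved are local. *)

theory Submission
  imports Defs "HOL-Library.FuncSet"
begin

text \<open>The basic polynomials, the Taylor coefficients and the conjugation are definite
  descriptions, so existence and uniqueness have to be established for each of them. Basic
  polynomials exist by an explicit product formula. Their uniqueness and the Taylor expansion rest
  on one estimate: a function whose iterated derivatives of order below d vanish at 0 is zero at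
  every lattice point x with 2(|x_1| + ... + |x_m|) < d. The same estimate makes the substituted
  series pointwise finite, because the rotated variables raise the order of vanishing just as the
  original ones do. The parity of the number of unit vectors enters through conj(w) = -w and w^2 =
  1: they give s conj(s) = (-1)^(2k) = 1, so that the Dirac operator applied after s is s applied
  after conj(s) partial s.\<close>

lemma anticommute_prod_list:
  fixes a :: "'a::ring_1"
  assumes "\<And>i. i \<in> set l \<Longrightarrow> a * g i = (- 1) ^ k i * (g i * a)"
  shows "a * prod_list (map g l) = (- 1) ^ sum_list (map k l) * (prod_list (map g l) * a)"
  using assms
proof (induction l)
  case (Cons i l)
  then have "a * g i = (- 1) ^ k i * (g i * a)"
    "a * prod_list (map g l) = (- 1) ^ sum_list (map k l) * (prod_list (map g l) * a)"
    by auto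
  then show ?case
    by (simp add: mult.assoc[symmetric]) (simp add: mult.assoc minus_one_power_iff)
qed auto

lemma mult_of_int_left: "a * (of_int m * b) = of_int m * (a * b :: 'a::ring_1)"
  by (metis mult.assoc mult_of_int_commute)

lemma real_vector_double_eq_0: "x + x = 0 \<Longrightarrow> x = (0 :: 'a::real_vector)"
  by (metis scaleR_2 scaleR_eq_0_iff zero_neq_numeral)

text \<open>Ordered products over all indices are cut at \<open>j\<close>. Since the prefix is
  exactly \<open>{..<j}\<close>, moving an operator with index \<open>j\<close> past it produces the
  exponent \<alpha>_1 + ... + \<alpha>_{j-1} of the signs.\<close>

lemma sorted_list_split:
  fixes j :: "'n::{finite,linorder}"
  obtains as bs where "sorted_list_of_set UNIV = as @ j # bs" "set as = {..<j}" "set bs = {j<..}"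
    "distinct as" "distinct bs"
proof -
  have "j \<in> set (sorted_list_of_set UNIV)" by simp
  then obtain as bs where split: "sorted_list_of_set UNIV = as @ j # bs"
    by (meson split_list)
  then have s: "sorted (as @ j # bs)" and d: "distinct (as @ j # bs)"
    and u: "set (as @ j # bs) = UNIV"
    by (metis sorted_sorted_list_of_set, metis distinct_sorted_list_of_set,
        metis finite set_sorted_list_of_set)
  from s d have lt: "i < j" if "i \<in> set as" for i
    using that by (fastforce simp: sorted_append order_less_le)
  from s d have gt: "j < i" if "i \<in> set bs" for i
    using that by (fastforce simp: sorted_append order_less_le)
  have m: "i \<in> set as \<or> i = j \<or> i \<in> set bs" for i
  proof -
    have "i \<in> set (as @ j # bs)" by (simp only: u UNIV_I)
    then show ?thesis by auto
  qed
  have "set as = {..<j}"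
    using lt gt m less_asym less_irrefl by (metis lessThan_iff subsetI subset_antisym)
  moreover have "set bs = {j<..}"
    using lt gt m less_asym less_irrefl by (metis greaterThan_iff subsetI subset_antisym)
  ultimately show thesis using split d by (intro that) auto
qed

section \<open>The Witt basis\<close>

lemma e_plus_square: "e_plus j * e_plus j = 0"
  by (rule real_vector_double_eq_0) (rule witt_relations)

lemma e_minus_square: "e_minus j * e_minus j = 0"
  by (rule real_vector_double_eq_0) (rule witt_relations)

lemma e_plus_e_minus: "e_plus j * e_minus j + e_minus j * e_plus j = 1"
  using witt_relations(3)[of j j] by simp

lemma e_plus_minus_plus: "e_plus j * (e_minus j * e_plus j) = e_plus j"
proof -
  have "e_plus j * (e_plus j * e_minus j + e_minus j * e_plus j) = e_plus j"
    by (simp add: e_plus_e_minus)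
  then show ?thesis by (simp add: distrib_left mult.assoc[symmetric] e_plus_square)
qed

lemma e_minus_plus_minus: "e_minus j * (e_plus j * e_minus j) = e_minus j"
proof -
  have "e_minus j * (e_plus j * e_minus j + e_minus j * e_plus j) = e_minus j"
    by (simp add: e_plus_e_minus)
  then show ?thesis by (simp add: distrib_left mult.assoc[symmetric] e_minus_square)
qed

lemma e_anticommute:
  assumes "i \<noteq> j"
  shows "e_plus i * e_plus j = - (e_plus j * e_plus i)"
    "e_minus i * e_minus j = - (e_minus j * e_minus i)"
    "e_plus i * e_minus j = - (e_minus j * e_plus i)"
    "e_minus i * e_plus j = - (e_plus j * e_minus i)"
  using assms witt_relations(1)[of i j] witt_relations(2)[of i j] witt_relations(3)[of i j]
    witt_relations(3)[of j i]
  by (simp_all add: eq_neg_iff_add_eq_0 add.commute)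

lemma e_vec_square: "e_vec j * e_vec j = 1"
  using e_plus_e_minus[of j]
  by (simp add: e_vec_def algebra_simps e_plus_square e_minus_square)

lemma e_vec_anticommute: "i \<noteq> j \<Longrightarrow> e_vec i * e_vec j = - (e_vec j * e_vec i)"
  by (simp add: e_vec_def algebra_simps e_anticommute[of i j])

section \<open>The basic polynomials\<close>

text \<open>The closed form of \<open>\<xi>_j^k[1]\<close> at \<open>x_j = t\<close>: the factors of the three Pochhammer symbols are
  consecutive integers around \<open>t\<close>, so that forward and backward differences lower \<open>k\<close> by one.\<close>

definition witt_poly :: "'n::{finite,linorder} \<Rightarrow> nat \<Rightarrow> int \<Rightarrow> 'n clifford" where
  "witt_poly j k t =
     (if odd k then of_int (pochhammer (t - int (k div 2)) k) * e_vec j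
      else of_int (pochhammer (t - int (k div 2) + 1) k) * (e_plus j * e_minus j)
         + of_int (pochhammer (t - int (k div 2)) k) * (e_minus j * e_plus j))"

lemma witt_poly_0: "witt_poly j 0 t = 1"
  by (simp add: witt_poly_def e_plus_e_minus)

lemma pochhammer_eq_0: "i < k \<Longrightarrow> pochhammer (- int i) k = 0"
  by (auto simp: pochhammer_prod)

lemma witt_poly_at_0: "0 < k \<Longrightarrow> witt_poly j k 0 = 0"
proof -
  assume "0 < k"
  show ?thesis
  proof (cases "odd k")
    case True
    then have "pochhammer (- int (k div 2)) k = 0"
      using \<open>0 < k\<close> by (intro pochhammer_eq_0) auto
    with True show ?thesis by (simp add: witt_poly_def)
  next
    case False
    with \<open>0 < k\<close> have "int (k div 2) \<ge> 1" by presburger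
    then have eq: "0 - int (k div 2) = - int (k div 2)" "- int (k div 2) + 1 = - int (k div 2 - 1)"
      by linarith+
    \<comment> \<open>With n = \<open>k div 2\<close> \<ge> 1 the two products run over -n, ..., n -
      1 and over 1 - n, ..., n; both contain the factor 0.\<close>
    have z: "pochhammer (- int (k div 2)) k = 0" "pochhammer (- int (k div 2 - 1)) k = 0"
      using \<open>0 < k\<close> by (auto intro!: pochhammer_eq_0)
    show ?thesis using False unfolding witt_poly_def eq z by simp
  qed
qed

lemma pochhammer_diff:
  fixes a :: "'a::comm_ring_1"
  shows "pochhammer (a + 1) k - pochhammer a k = of_nat k * pochhammer (a + 1) (k - 1)"
proof (cases k)
  case (Suc n)
  show ?thesis unfolding Suc pochhammer_rec[of a] pochhammer_Suc[of "a + 1"]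
    by (simp add: algebra_simps)
qed simp

text \<open>For odd \<open>k\<close> the forward difference lands on the idempotent
  \<open>e_plus j * e_minus j\<close> and the backward one on \<open>e_minus j * e_plus j\<close>.
  For even \<open>k\<close> the generator \<open>e_plus j\<close> kills the first idempotent and
  \<open>e_minus j\<close> the second; the shift by one between the two products makes the surviving
  forward and backward differences equal, so that they recombine to a multiple of
  \<open>e_vec j\<close>.\<close>

lemma witt_poly_diff:
  "e_plus j * (witt_poly j k (t + 1) - witt_poly j k t)
     + e_minus j * (witt_poly j k t - witt_poly j k (t - 1)) = of_nat k * witt_poly j (k - 1) t"
proof (cases "odd k")
  case True
  define n where "n = k div 2"
  have k: "k = 2 * n + 1" using True by (simp add: n_def)
  let ?p = "\<lambda>a. pochhammer a k"
  have up: "e_plus j * (of_int c * e_vec j) = of_int c * (e_plus j * e_minus j)" for c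
    by (simp add: mult_of_int_left) (simp add: e_vec_def distrib_left e_plus_square)
  have um: "e_minus j * (of_int c * e_vec j) = of_int c * (e_minus j * e_plus j)" for c
    by (simp add: mult_of_int_left) (simp add: e_vec_def distrib_left e_minus_square)
  have "e_plus j * (witt_poly j k (t + 1) - witt_poly j k t)
     + e_minus j * (witt_poly j k t - witt_poly j k (t - 1))
     = of_int (?p (t - int n + 1) - ?p (t - int n)) * (e_plus j * e_minus j)
     + of_int (?p (t - int n) - ?p (t - int n - 1)) * (e_minus j * e_plus j)"
    using True
    by (simp add: witt_poly_def right_diff_distrib left_diff_distrib up um n_def[symmetric] algebra_simps)
  also have "\<dots> = of_nat k * witt_poly j (k - 1) t"
    using pochhammer_diff[of "t - int n" k] pochhammer_diff[of "t - int n - 1" k] True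
    by (simp add: witt_poly_def k algebra_simps)
  finally show ?thesis .
next
  case False
  define n where "n = k div 2"
  have k: "k = 2 * n" using False by (simp add: n_def)
  show ?thesis
  proof (cases "n = 0")
    case True
    then show ?thesis by (simp add: k witt_poly_0)
  next
    case n: False
    let ?p = "\<lambda>a. pochhammer a k"
    have up: "e_plus j * (of_int c * (e_plus j * e_minus j) + of_int d * (e_minus j * e_plus j))
        = of_int d * e_plus j" for c d
      by (simp add: distrib_left mult_of_int_left e_plus_minus_plus)
         (simp add: mult.assoc[symmetric] e_plus_square)
    have um: "e_minus j * (of_int c * (e_plus j * e_minus j) + of_int d * (e_minus j * e_plus j))
        = of_int c * e_minus j" for c d
      by (simp add: distrib_left mult_of_int_left e_minus_plus_minus)
         (simp add: mult.assoc[symmetric] e_minus_square)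
    have "e_plus j * (witt_poly j k (t + 1) - witt_poly j k t)
       + e_minus j * (witt_poly j k t - witt_poly j k (t - 1))
       = of_int (?p (t - int n + 1) - ?p (t - int n)) * e_plus j
       + of_int (?p (t - int n + 1) - ?p (t - int n)) * e_minus j"
      using False
      by (simp add: witt_poly_def right_diff_distrib up um n_def[symmetric])
         (simp add: algebra_simps)
    also have "\<dots> = of_nat k * witt_poly j (k - 1) t"
    proof -
      have "odd (k - 1)" "(k - 1) div 2 = n - 1" "int (n - 1) = int n - 1"
        using n k by auto
      then show ?thesis
        using pochhammer_diff[of "t - int n" k]
        by (simp add: witt_poly_def e_vec_def algebra_simps)
    qed
    finally show ?thesis .
  qed
qed

text \<open>Each term of \<open>witt_poly i k t\<close> is an integer times one generator (odd
  \<open>k\<close>) or a product of two (even \<open>k\<close>), so the number of sign changes has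
  the parity of \<open>k\<close>.\<close>

lemma anticommute_witt_poly:
  assumes p: "g * e_plus i = - (e_plus i * g)" and m: "g * e_minus i = - (e_minus i * g)"
  shows "g * witt_poly i k t = (- 1) ^ k * (witt_poly i k t * g)"
proof -
  have v: "g * e_vec i = - (e_vec i * g)"
    by (simp add: e_vec_def distrib_left distrib_right p m)
  have pm: "g * (e_plus i * e_minus i) = e_plus i * (e_minus i * g)"
  proof -
    have "g * (e_plus i * e_minus i) = g * e_plus i * e_minus i" by (simp only: mult.assoc)
    also have "\<dots> = - (e_plus i * (g * e_minus i))" by (simp add: p mult.assoc)
    finally show ?thesis by (simp add: m)
  qed
  have mp: "g * (e_minus i * e_plus i) = e_minus i * (e_plus i * g)"
  proof -
    have "g * (e_minus i * e_plus i) = g * e_minus i * e_plus i" by (simp only: mult.assoc)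
    also have "\<dots> = - (e_minus i * (g * e_plus i))" by (simp add: m mult.assoc)
    finally show ?thesis by (simp add: p)
  qed
  show ?thesis
  proof (cases "odd k")
    case True
    then show ?thesis by (simp add: witt_poly_def mult_of_int_left v mult.assoc)
  next
    case False
    then show ?thesis
      by (simp add: witt_poly_def mult_of_int_left pm mp mult.assoc distrib_left distrib_right)
  qed
qed

lemma e_witt_poly:
  assumes "i \<noteq> j"
  shows "e_plus j * witt_poly i k t = (- 1) ^ k * (witt_poly i k t * e_plus j)"
    and "e_minus j * witt_poly i k t = (- 1) ^ k * (witt_poly i k t * e_minus j)"
  using e_anticommute[OF assms[symmetric]] by (auto intro: anticommute_witt_poly)

definition witt_prod :: "'n::{finite,linorder} mindex \<Rightarrow> 'n dfun" where
  "witt_prod \<alpha> x = prod_list (map (\<lambda>j. witt_poly j (\<alpha> j) (x j)) (sorted_list_of_set UNIV))"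

text \<open>Only the factor with index \<open>j\<close> depends on x_j; the generators pass the
  factors before it at the cost of the sign, and the one-dimensional rule
  \<open>witt_poly_diff\<close> applies to it.\<close>

lemma partial_witt_prod:
  "partial j (witt_prod \<alpha>)
     = (\<lambda>x. (- 1) ^ (\<Sum>i<j. \<alpha> i) * of_nat (\<alpha> j) * witt_prod (\<alpha>(j := \<alpha> j - 1)) x)"
proof
  fix x
  obtain as bs where split: "sorted_list_of_set UNIV = as @ j # bs" "set as = {..<j}"
    "set bs = {j<..}" "distinct as" "distinct bs"
    by (rule sorted_list_split)
  define A where "A = prod_list (map (\<lambda>j. witt_poly j (\<alpha> j) (x j)) as)"
  define B where "B = prod_list (map (\<lambda>j. witt_poly j (\<alpha> j) (x j)) bs)"
  have cong_as: "map (\<lambda>i. witt_poly i ((\<alpha>(j := k)) i) ((x(j := t)) i)) as = map (\<lambda>j. witt_poly j (\<alpha> j) (x j)) as"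
    and cong_bs: "map (\<lambda>i. witt_poly i ((\<alpha>(j := k)) i) ((x(j := t)) i)) bs = map (\<lambda>j. witt_poly j (\<alpha> j) (x j)) bs"
    for k t
    using split by auto
  have W: "witt_prod (\<alpha>(j := k)) (x(j := t)) = A * (witt_poly j k t * B)" for k t
    unfolding witt_prod_def split map_append list.map prod_list.append prod_list.Cons cong_as cong_bs
    by (simp add: A_def B_def)
  note W1 = W[of "\<alpha> j", simplified fun_upd_triv] and W2 = W[of _ "x j", simplified fun_upd_triv]
    and W3 = W[of "\<alpha> j" "x j", simplified fun_upd_triv]
  have s: "sum_list (map \<alpha> as) = (\<Sum>i<j. \<alpha> i)"
    using split by (simp add: sum_list_distinct_conv_sum_set)
  have ep: "e_plus j * A = (- 1) ^ (\<Sum>i<j. \<alpha> i) * (A * e_plus j)"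
    unfolding A_def s[symmetric] using split
    by (intro anticommute_prod_list e_witt_poly) auto
  have em: "e_minus j * A = (- 1) ^ (\<Sum>i<j. \<alpha> i) * (A * e_minus j)"
    unfolding A_def s[symmetric] using split
    by (intro anticommute_prod_list e_witt_poly) auto
  let ?w = "witt_poly j (\<alpha> j)" and ?s = "(- 1) ^ (\<Sum>i<j. \<alpha> i) :: 'a clifford"
  have "partial j (witt_prod \<alpha>) x
      = e_plus j * A * ((?w (x j + 1) - ?w (x j)) * B) + e_minus j * A * ((?w (x j) - ?w (x j - 1)) * B)"
    unfolding partial_def fwd_diff_def bwd_diff_def W1 W3
    by (simp add: algebra_simps)
  also have "\<dots> = ?s * A * (e_plus j * (?w (x j + 1) - ?w (x j)) + e_minus j * (?w (x j) - ?w (x j - 1))) * B"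
    unfolding ep em by (simp only: distrib_left distrib_right mult.assoc)
  also have "\<dots> = ?s * of_nat (\<alpha> j) * witt_prod (\<alpha>(j := \<alpha> j - 1)) x"
    unfolding witt_poly_diff W2 by (simp only: mult.assoc) (metis mult.assoc mult_of_nat_commute)
  finally show "partial j (witt_prod \<alpha>) x = ?s * of_nat (\<alpha> j) * witt_prod (\<alpha>(j := \<alpha> j - 1)) x" .
qed

lemma prod_list_one: "prod_list (map (\<lambda>_. 1) l) = (1 :: 'a::monoid_mult)"
  by (induction l) auto

lemma prod_list_eq_0: "0 \<in> set l \<Longrightarrow> prod_list l = (0 :: 'a::ring_1)"
  by (induction l) auto

lemma is_basic_family_witt_prod: "is_basic_family witt_prod"
  unfolding is_basic_family_def
proof (intro conjI allI impI)
  show "witt_prod (\<lambda>_. 0) = (\<lambda>_. 1)"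
    by (simp only: fun_eq_iff witt_prod_def witt_poly_0 prod_list_one simp_thms)
next
  fix \<alpha> :: "'a mindex" assume "\<alpha> \<noteq> (\<lambda>_. 0)"
  then obtain j where "\<alpha> j > 0" by auto
  then have "witt_poly j (\<alpha> j) 0 = 0" by (rule witt_poly_at_0)
  then have "\<exists>j. witt_poly j (\<alpha> j) 0 = 0" ..
  then show "witt_prod \<alpha> (\<lambda>_. 0) = 0"
    unfolding witt_prod_def by (intro prod_list_eq_0) (auto simp: image_iff)
qed (rule partial_witt_prod)

section \<open>Functions whose Taylor expansion starts in a given degree\<close>

text \<open>Membership is tested on iterated partial derivatives at the origin, so that no Taylor
  coefficients are needed yet.\<close>

primrec vanishes :: "nat \<Rightarrow> 'n::{finite,linorder} dfun \<Rightarrow> bool" where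
  "vanishes 0 f \<longleftrightarrow> True"
| "vanishes (Suc d) f \<longleftrightarrow> f (\<lambda>_. 0) = 0 \<and> (\<forall>j. vanishes d (partial j f))"

lemma vanishes_mono: "vanishes d f \<Longrightarrow> d' \<le> d \<Longrightarrow> vanishes d' f"
proof (induction d arbitrary: d' f)
  case (Suc d)
  then show ?case by (cases d') auto
qed auto

text \<open>Since \<open>e_plus j\<close> and \<open>e_minus j\<close> square to zero and their
  anticommutator is 1, \<open>partial j\<close> is a square root of the one-dimensional discrete
  Laplacian.\<close>

lemma partial_partial:
  "partial j (partial j f) x = f (x(j := x j + 1)) + f (x(j := x j - 1)) - (f x + f x)"
proof -
  let ?g = "partial j f" and ?u = "x(j := x j + 1)" and ?v = "x(j := x j - 1)"
  have ep: "e_plus j * partial j f y = e_plus j * e_minus j * (f y - f (y(j := y j - 1)))" for y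
    by (simp add: partial_def distrib_left fwd_diff_def bwd_diff_def mult.assoc[symmetric] e_plus_square)
  have em: "e_minus j * partial j f y = e_minus j * e_plus j * (f (y(j := y j + 1)) - f y)" for y
    by (simp add: partial_def distrib_left fwd_diff_def bwd_diff_def mult.assoc[symmetric] e_minus_square)
  let ?w = "f ?u + f ?v - (f x + f x)"
  have "partial j ?g x = e_plus j * ?g ?u - e_plus j * ?g x + (e_minus j * ?g x - e_minus j * ?g ?v)"
    by (simp add: partial_def[of j "partial j f"] fwd_diff_def bwd_diff_def right_diff_distrib)
  also have "\<dots> = (e_plus j * e_minus j + e_minus j * e_plus j) * ?w"
    unfolding ep em by (simp add: algebra_simps)
  finally show ?thesis by (simp add: e_plus_e_minus)
qed

text \<open>The second derivative forces the two neighbouring values to be u and -u. Multiplying the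
  first derivative by \<open>e_plus j\<close> and by \<open>e_minus j\<close> then shows that both
  idempotents annihilate u, and these add up to 1.\<close>

lemma neighbours_eq_0:
  assumes "f x = 0" "partial j f x = 0" "partial j (partial j f) x = 0"
  shows "f (x(j := x j + 1)) = 0" "f (x(j := x j - 1)) = 0"
proof -
  define u v where uv: "u = f (x(j := x j + 1))" "v = f (x(j := x j - 1))"
  have d: "e_plus j * u - e_minus j * v = 0"
    using assms(1,2) by (simp add: partial_def fwd_diff_def bwd_diff_def uv)
  have "u + v = 0" using assms(1,3) by (simp add: partial_partial uv)
  then have v: "v = - u" by (simp add: eq_neg_iff_add_eq_0 add.commute)
  have "e_plus j * (e_plus j * u - e_minus j * v) = 0" "e_minus j * (e_plus j * u - e_minus j * v) = 0"
    by (simp_all add: d)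
  then have "e_plus j * e_minus j * u = 0" "e_minus j * e_plus j * u = 0"
    by (simp_all add: v right_diff_distrib distrib_left mult.assoc[symmetric] e_plus_square e_minus_square)
  then have "(e_plus j * e_minus j + e_minus j * e_plus j) * u = 0"
    by (simp add: distrib_right)
  then have "u = 0" by (simp add: e_plus_e_minus)
  with v show "f (x(j := x j + 1)) = 0" "f (x(j := x j - 1)) = 0" by (simp_all add: uv)
qed

definition height :: "'n::finite lattice \<Rightarrow> nat" where
  "height x = (\<Sum>j\<in>UNIV. nat \<bar>x j\<bar>)"

text \<open>Every unit step away from the origin costs two orders of vanishing, because
  \<open>neighbours_eq_0\<close> needs the function and its first two derivatives at the point
  closer to the origin; hence the factor 2.\<close>

lemma vanishes_imp_eq_0:
  assumes "vanishes d f" "2 * height x < d"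
  shows "f x = 0"
  using assms
proof (induction "height x" arbitrary: x f d)
  case 0
  then have "x = (\<lambda>_. 0)" by (auto simp: height_def fun_eq_iff)
  with 0 show ?case by (cases d) auto
next
  case (Suc h)
  then have "height x \<noteq> 0" by simp
  then obtain j where j: "x j \<noteq> 0" unfolding height_def by (metis nat_0 abs_zero sum.neutral)
  define y where "y = x(j := x j - sgn (x j))"
  have "height z = nat \<bar>z j\<bar> + (\<Sum>i\<in>UNIV - {j}. nat \<bar>z i\<bar>)" for z :: "'a lattice"
    by (simp add: height_def sum.remove[of UNIV j])
  moreover have "nat \<bar>x j\<bar> = Suc (nat \<bar>y j\<bar>)"
    using j by (auto simp: y_def sgn_if)
  moreover have "(\<Sum>i\<in>UNIV - {j}. nat \<bar>x i\<bar>) = (\<Sum>i\<in>UNIV - {j}. nat \<bar>y i\<bar>)"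
    by (rule sum.cong) (auto simp: y_def)
  ultimately have h: "h = height y" using Suc.hyps(2) by simp
  define d' where "d' = d - 2"
  have d': "d = Suc (Suc d')" "2 * h < d'"
    using Suc.hyps(2) Suc.prems(2) by (simp_all add: d'_def)
  have v: "vanishes d' f" "vanishes d' (partial j f)" "vanishes d' (partial j (partial j f))"
    using Suc.prems(1) vanishes_mono[of d f d'] vanishes_mono[of "Suc d'" "partial j f" d']
    by (auto simp: d')
  have "f y = 0" "partial j f y = 0" "partial j (partial j f) y = 0"
    using Suc.hyps(1)[OF h v(1)] Suc.hyps(1)[OF h v(2)] Suc.hyps(1)[OF h v(3)] d' h by auto
  note nb = neighbours_eq_0[OF this]
  have "x = y(j := y j + 1) \<or> x = y(j := y j - 1)"
    using j by (auto simp: y_def sgn_if fun_eq_iff)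
  with nb show ?case by metis
qed

lemma vanishes_all_imp_eq_0: "(\<And>d. vanishes d f) \<Longrightarrow> f = (\<lambda>_. 0)"
  using vanishes_imp_eq_0[of "Suc (2 * height x)" f x for x] by auto

section \<open>Uniqueness of the basic polynomials\<close>

lemma partial_add: "partial j (\<lambda>x. f x + g x) = (\<lambda>x. partial j f x + partial j g x)"
  by (simp add: fun_eq_iff partial_def fwd_diff_def bwd_diff_def algebra_simps)

lemma partial_mult_right: "partial j (\<lambda>x. f x * c) = (\<lambda>x. partial j f x * c)"
  by (simp add: fun_eq_iff partial_def fwd_diff_def bwd_diff_def algebra_simps)

lemma partial_mult_int: "partial j (\<lambda>x. of_int c * f x) = (\<lambda>x. of_int c * partial j f x)"
  using partial_mult_right[of j f "of_int c"] by (simp add: mult_of_int_commute)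

lemma basic_family_unique:
  assumes "is_basic_family p" "is_basic_family q"
  shows "p = q"
proof
  fix \<alpha>
  \<comment> \<open>Differentiating c times the difference at \<alpha> yields an integer multiple of
    the difference at the lowered index. Allowing every integer factor \<open>c\<close> makes the
    induction close.\<close>
  have "vanishes d (\<lambda>x. of_int c * p \<alpha> x + of_int (- c) * q \<alpha> x)" for d c
  proof (induction d arbitrary: c \<alpha>)
    case (Suc d)
    have "p \<alpha> (\<lambda>_. 0) = q \<alpha> (\<lambda>_. 0)"
      using assms by (cases "\<alpha> = (\<lambda>_. 0)") (auto simp: is_basic_family_def)
    moreover have "vanishes d (partial j (\<lambda>x. of_int c * p \<alpha> x + of_int (- c) * q \<alpha> x))" for j
    proof -
      have "partial j (p \<alpha>) = (\<lambda>x. (- 1) ^ (\<Sum>i<j. \<alpha> i) * of_nat (\<alpha> j) * p (\<alpha>(j := \<alpha> j - 1)) x)"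
        "partial j (q \<alpha>) = (\<lambda>x. (- 1) ^ (\<Sum>i<j. \<alpha> i) * of_nat (\<alpha> j) * q (\<alpha>(j := \<alpha> j - 1)) x)"
        using assms by (auto simp: is_basic_family_def)
      then have eq: "partial j (\<lambda>x. of_int c * p \<alpha> x + of_int (- c) * q \<alpha> x)
        = (\<lambda>x. of_int (c * (- 1) ^ (\<Sum>i<j. \<alpha> i) * int (\<alpha> j)) * p (\<alpha>(j := \<alpha> j - 1)) x
          + of_int (- (c * (- 1) ^ (\<Sum>i<j. \<alpha> i) * int (\<alpha> j))) * q (\<alpha>(j := \<alpha> j - 1)) x)"
        by (simp only: partial_add partial_mult_int) (simp add: mult.assoc)
      show ?thesis unfolding eq by (rule Suc.IH)
    qed
    ultimately show ?case by simp
  qed simp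
  from this[of _ 1] have "vanishes d (\<lambda>x. p \<alpha> x - q \<alpha> x)" for d by simp
  from vanishes_all_imp_eq_0[OF this] show "p \<alpha> = q \<alpha>" by (simp add: fun_eq_iff)
qed

lemma is_basic_family_basic_poly: "is_basic_family basic_poly"
proof -
  have "\<exists>!p :: 'a mindex \<Rightarrow> 'a dfun. is_basic_family p"
    using is_basic_family_witt_prod basic_family_unique by blast
  then show ?thesis unfolding basic_poly_def by (rule theI')
qed

section \<open>Local right linear operators\<close>

text \<open>Locality (each value depends on finitely many values of the argument) replaces continuity:
  such operators may be applied term by term to pointwise finite series.\<close>

definition local_linear :: "'n::{finite,linorder} dop \<Rightarrow> bool" where
  "local_linear L \<longleftrightarrow>
     (\<forall>f g. L (\<lambda>x. f x + g x) = (\<lambda>x. L f x + L g x)) \<and>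
     (\<forall>f c. L (\<lambda>x. f x * c) = (\<lambda>x. L f x * c)) \<and>
     (\<forall>x. \<exists>Y. finite Y \<and> (\<forall>f. (\<forall>y\<in>Y. f y = 0) \<longrightarrow> L f x = 0))"

lemma local_linearI:
  assumes "\<And>f g x. L (\<lambda>x. f x + g x) x = L f x + L g x"
    and "\<And>f c x. L (\<lambda>x. f x * c) x = L f x * c"
    and "\<And>x. \<exists>Y. finite Y \<and> (\<forall>f. (\<forall>y\<in>Y. f y = 0) \<longrightarrow> L f x = 0)"
  shows "local_linear L"
  using assms by (auto simp: local_linear_def fun_eq_iff)

lemma local_linearD:
  assumes "local_linear L"
  shows "L (\<lambda>x. f x + g x) = (\<lambda>x. L f x + L g x)"
    and "L (\<lambda>x. f x * c) = (\<lambda>x. L f x * c)"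
    and "\<exists>Y. finite Y \<and> (\<forall>f. (\<forall>y\<in>Y. f y = 0) \<longrightarrow> L f x = 0)"
  using assms by (auto simp: local_linear_def)

lemma local_linear_id: "local_linear (\<lambda>f. f)"
  by (rule local_linearI) (auto intro: exI[of _ "{_}"])

lemma local_linear_zero: "local_linear (\<lambda>f x. 0)"
  by (rule local_linearI) auto

lemma local_linear_plus:
  assumes "local_linear L" "local_linear M"
  shows "local_linear (\<lambda>f x. L f x + M f x)"
proof (rule local_linearI)
  fix x
  obtain Y Z where "finite Y" "\<And>f. \<forall>y\<in>Y. f y = 0 \<Longrightarrow> L f x = 0"
    "finite Z" "\<And>f. \<forall>y\<in>Z. f y = 0 \<Longrightarrow> M f x = 0"
    using local_linearD(3)[OF assms(1), of x] local_linearD(3)[OF assms(2), of x] by blast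
  then show "\<exists>Y. finite Y \<and> (\<forall>f. (\<forall>y\<in>Y. f y = 0) \<longrightarrow> L f x + M f x = 0)"
    by (intro exI[of _ "Y \<union> Z"]) auto
qed (auto simp: local_linearD[OF assms(1)] local_linearD[OF assms(2)] algebra_simps)

lemma local_linear_scaleR:
  assumes "local_linear L"
  shows "local_linear (\<lambda>f x. r *\<^sub>R L f x)"
proof (rule local_linearI)
  fix x
  show "\<exists>Y. finite Y \<and> (\<forall>f. (\<forall>y\<in>Y. f y = 0) \<longrightarrow> r *\<^sub>R L f x = 0)"
    using local_linearD(3)[OF assms, of x] by auto
qed (simp_all add: local_linearD[OF assms] scaleR_right_distrib)

lemma local_linear_minus:
  assumes "local_linear L" "local_linear M"
  shows "local_linear (\<lambda>f x. L f x - M f x)"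
  using local_linear_plus[OF assms(1) local_linear_scaleR[OF assms(2), of "- 1"]] by simp

lemma local_linear_comp:
  assumes "local_linear L" "local_linear M"
  shows "local_linear (\<lambda>f. L (M f))"
proof (rule local_linearI)
  fix x
  obtain Y where Y: "finite Y" "\<And>f. \<forall>y\<in>Y. f y = 0 \<Longrightarrow> L f x = 0"
    using local_linearD(3)[OF assms(1), of x] by blast
  obtain Z where Z: "\<And>y. finite (Z y)" "\<And>y f. \<forall>z\<in>Z y. f z = 0 \<Longrightarrow> M f y = 0"
    using local_linearD(3)[OF assms(2)] by metis
  show "\<exists>Y. finite Y \<and> (\<forall>f. (\<forall>y\<in>Y. f y = 0) \<longrightarrow> L (M f) x = 0)"
    using Y(1) Z(1) by (intro exI[of _ "\<Union>(Z ` Y)"]) (auto intro!: Y(2) Z(2))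
qed (simp_all add: local_linearD[OF assms(1)] local_linearD[OF assms(2)])

text \<open>As a type of their own, with composition as product, these operators form a unital real
  algebra, so that relations between them can be computed with ring laws and finite sums.\<close>

typedef (overloaded) ('n::"{finite,linorder}") lop = "{L :: 'n dop. local_linear L}"
  morphisms app Lop
  using local_linear_id by blast

setup_lifting type_definition_lop

instantiation lop :: ("{finite,linorder}") real_algebra_1
begin

lift_definition zero_lop :: "'a lop" is "\<lambda>f x. 0" by (rule local_linear_zero)
lift_definition one_lop :: "'a lop" is "\<lambda>f. f" by (rule local_linear_id)
lift_definition plus_lop :: "'a lop \<Rightarrow> 'a lop \<Rightarrow> 'a lop" is "\<lambda>L M f x. L f x + M f x"
  by (rule local_linear_plus)
lift_definition uminus_lop :: "'a lop \<Rightarrow> 'a lop" is "\<lambda>L f x. - L f x"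
  using local_linear_scaleR[of _ "- 1"] by simp
lift_definition minus_lop :: "'a lop \<Rightarrow> 'a lop \<Rightarrow> 'a lop" is "\<lambda>L M f x. L f x - M f x"
  by (rule local_linear_minus)
lift_definition times_lop :: "'a lop \<Rightarrow> 'a lop \<Rightarrow> 'a lop" is "\<lambda>L M f. L (M f)"
  by (rule local_linear_comp)
lift_definition scaleR_lop :: "real \<Rightarrow> 'a lop \<Rightarrow> 'a lop" is "\<lambda>r L f x. r *\<^sub>R L f x"
  by (rule local_linear_scaleR)

instance
proof
  fix a b c :: "'a lop" and r t :: real
  show "a + b + c = a + (b + c)" by transfer (simp add: add.assoc)
  show "a + b = b + a" by transfer (simp add: add.commute)
  show "0 + a = a" by transfer simp
  show "- a + a = 0" by transfer simp
  show "a - b = a + - b" by transfer simp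
  show "a * b * c = a * (b * c)" by transfer simp
  show "1 * a = a" by transfer simp
  show "a * 1 = a" by transfer simp
  show "(a + b) * c = a * c + b * c" by transfer simp
  show "a * (b + c) = a * b + a * c" by transfer (simp add: local_linearD)
  show "(0 :: 'a lop) \<noteq> 1" by transfer (metis zero_neq_one)
  show "r *\<^sub>R (a + b) = r *\<^sub>R a + r *\<^sub>R b" by transfer (simp add: scaleR_right_distrib)
  show "(r + t) *\<^sub>R a = r *\<^sub>R a + t *\<^sub>R a" by transfer (simp add: scaleR_left_distrib)
  show "r *\<^sub>R t *\<^sub>R a = (r * t) *\<^sub>R a" by transfer simp
  show "1 *\<^sub>R a = a" by transfer simp
  show "r *\<^sub>R a * b = r *\<^sub>R (a * b)" by transfer simp
  show "a * r *\<^sub>R b = r *\<^sub>R (a * b)"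
  proof transfer
    fix L M :: "'a dop" and r :: real assume "local_linear L"
    \<comment> \<open>Real homogeneity is right linearity for the coefficient
      \<open>r *\<^sub>R 1\<close>.\<close>
    from local_linearD(2)[OF this, of _ "r *\<^sub>R 1"]
    show "(\<lambda>f. L (\<lambda>x. r *\<^sub>R M f x)) = (\<lambda>f x. r *\<^sub>R L (M f) x)" by simp
  qed
qed

end

lemma app_simps [simp]:
  "app 0 f x = 0" "app 1 f = f" "app (A + B) f x = app A f x + app B f x"
  "app (- A) f x = - app A f x" "app (A - B) f x = app A f x - app B f x"
  "app (A * B) f = app A (app B f)" "app (r *\<^sub>R A) f x = r *\<^sub>R app A f x"
  by (simp_all add: zero_lop.rep_eq one_lop.rep_eq plus_lop.rep_eq uminus_lop.rep_eq
      minus_lop.rep_eq times_lop.rep_eq scaleR_lop.rep_eq)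

lemma app_sum_left: "app (\<Sum>i\<in>I. A i) f x = (\<Sum>i\<in>I. app (A i) f x)"
  by (induction I rule: infinite_finite_induct) auto

lemma app_sign: "app ((- 1) ^ k * A) f x = (- 1) ^ k * app A f x"
  by (simp add: minus_one_power_iff)

lemma local_linear_app: "local_linear (app A)"
  using app[of A] by simp

lemma app_add_right: "app A (\<lambda>x. f x + g x) = (\<lambda>x. app A f x + app A g x)"
  by (rule local_linearD(1)[OF local_linear_app])

lemma app_mult_right: "app A (\<lambda>x. f x * c) = (\<lambda>x. app A f x * c)"
  by (rule local_linearD(2)[OF local_linear_app])

lemma app_zero_right: "app A (\<lambda>x. 0) = (\<lambda>x. 0)"
  using app_mult_right[of A "\<lambda>x. 0" 0] by simp

lemma app_uminus_right: "app A (\<lambda>x. - f x) = (\<lambda>x. - app A f x)"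
  using app_mult_right[of A f "- 1"] by simp

lemma app_diff_right: "app A (\<lambda>x. f x - g x) = (\<lambda>x. app A f x - app A g x)"
  using app_add_right[of A f "\<lambda>x. - g x"] by (simp add: app_uminus_right)

lemma app_sum_right: "app A (\<lambda>x. \<Sum>i\<in>I. f i x) = (\<lambda>x. \<Sum>i\<in>I. app A (f i) x)"
  by (induction I rule: infinite_finite_induct) (auto simp: app_zero_right app_add_right)

lemma app_local: "\<exists>Y. finite Y \<and> (\<forall>f. (\<forall>y\<in>Y. f y = 0) \<longrightarrow> app A f x = 0)"
  by (rule local_linearD(3)[OF local_linear_app])

lemma lop_eqI: "(\<And>f. app A f = app B f) \<Longrightarrow> A = B"
  by (simp add: app_inject[symmetric] fun_eq_iff)

lemma series_eq_sum:
  assumes "finite A" "{\<alpha>. T \<alpha> x \<noteq> 0} \<subseteq> A"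
  shows "series T x = (\<Sum>\<alpha>\<in>A. T \<alpha> x)"
  unfolding series_def using assms by (rule Sum_any.expand_superset)

lemma app_series:
  assumes "\<And>x. finite {\<alpha>. T \<alpha> x \<noteq> 0}"
  shows "\<exists>A0. finite A0 \<and>
    (\<forall>A. finite A \<longrightarrow> A0 \<subseteq> A \<longrightarrow> app L (series T) x = (\<Sum>\<alpha>\<in>A. app L (T \<alpha>) x))"
proof -
  obtain Y where Y: "finite Y" "\<And>f. \<forall>y\<in>Y. f y = 0 \<Longrightarrow> app L f x = 0"
    using app_local by blast
  define A0 where "A0 = (\<Union>y\<in>Y. {\<alpha>. T \<alpha> y \<noteq> 0})"
  have "app L (series T) x = (\<Sum>\<alpha>\<in>A. app L (T \<alpha>) x)" if A: "finite A" "A0 \<subseteq> A" for A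
  proof -
    have "app L (\<lambda>y. series T y - (\<Sum>\<alpha>\<in>A. T \<alpha> y)) x = 0"
    proof (rule Y(2), rule ballI)
      fix y assume "y \<in> Y"
      then have "series T y = (\<Sum>\<alpha>\<in>A. T \<alpha> y)"
        using A by (intro series_eq_sum) (auto simp: A0_def)
      then show "series T y - (\<Sum>\<alpha>\<in>A. T \<alpha> y) = 0" by simp
    qed
    then show ?thesis by (simp add: app_diff_right app_sum_right)
  qed
  moreover have "finite A0" using Y(1) assms by (simp add: A0_def)
  ultimately show ?thesis by blast
qed

section \<open>Taylor expansion\<close>

lemma basic_poly_0: "basic_poly (\<lambda>_. 0) = (\<lambda>_. 1)"
  and partial_basic_poly: "partial j (basic_poly \<alpha>) =
        (\<lambda>x. (- 1) ^ (\<Sum>i<j. \<alpha> i) * of_nat (\<alpha> j) * basic_poly (\<alpha>(j := \<alpha> j - 1)) x)"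
  and basic_poly_at_0: "\<alpha> \<noteq> (\<lambda>_. 0) \<Longrightarrow> basic_poly \<alpha> (\<lambda>_. 0) = 0"
  using is_basic_family_basic_poly by (auto simp: is_basic_family_def)

text \<open>A coefficient on the right absorbs signs and generators: \<open>partial j\<close>,
  \<open>xi j\<close> and \<open>R_op j\<close> send each such term to a single term.\<close>

definition basic_term :: "'n::{finite,linorder} mindex \<Rightarrow> 'n clifford \<Rightarrow> 'n dfun" where
  "basic_term \<alpha> c = (\<lambda>x. basic_poly \<alpha> x * c)"

lemma basic_term_zero [simp]: "basic_term \<alpha> 0 = (\<lambda>x. 0)" "basic_term \<alpha> 0 x = 0"
  by (auto simp: basic_term_def)

lemma basic_term_minus: "basic_term \<alpha> (- c) = (\<lambda>x. - basic_term \<alpha> c x)"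
  by (simp add: basic_term_def)

lemma mult_of_nat_left: "a * (of_nat m * b) = of_nat m * (a * b :: 'a::ring_1)"
  by (metis mult.assoc mult_of_nat_commute)

lemma partial_basic_term:
  "partial j (basic_term \<alpha> c)
     = basic_term (\<alpha>(j := \<alpha> j - 1)) ((- 1) ^ (\<Sum>i<j. \<alpha> i) * of_nat (\<alpha> j) * c)"
  unfolding basic_term_def partial_mult_right partial_basic_poly
  by (simp add: fun_eq_iff minus_one_power_iff mult.assoc mult_of_nat_left)

lemma vanishes_zero: "vanishes d (\<lambda>x. 0)"
proof (induction d)
  case (Suc d)
  have "partial j (\<lambda>x. 0) = (\<lambda>x. 0)" for j :: 'a
    by (simp add: fun_eq_iff partial_def fwd_diff_def bwd_diff_def)
  with Suc show ?case by simp
qed simp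

lemma vanishes_basic_term: "vanishes (sum \<alpha> UNIV) (basic_term \<alpha> c)"
proof (induction "sum \<alpha> UNIV" arbitrary: \<alpha> c)
  case (Suc d)
  then have "\<alpha> \<noteq> (\<lambda>_. 0)" by auto
  then have "basic_term \<alpha> c (\<lambda>_. 0) = 0" by (simp add: basic_term_def basic_poly_at_0)
  moreover have "vanishes d (partial j (basic_term \<alpha> c))" for j
  \<comment> \<open>By truncated subtraction the degree does not drop when
    \<open>\<alpha> j = 0\<close>; there the factor \<open>\<alpha> j\<close> makes the derivative
    zero.\<close>
  proof (cases "\<alpha> j = 0")
    case True
    then show ?thesis by (simp add: partial_basic_term vanishes_zero)
  next
    case False
    then have d: "d = sum (\<alpha>(j := \<alpha> j - 1)) UNIV"
      using Suc.hyps(2) sum.remove[of UNIV j \<alpha>] sum.remove[of UNIV j "\<alpha>(j := \<alpha> j - 1)"]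
      by simp
    show ?thesis unfolding partial_basic_term d by (rule Suc.hyps(1)[OF d])
  qed
  ultimately show ?case by (simp flip: Suc.hyps(2))
qed simp

lemma finite_mindex: "finite {\<alpha> :: 'n::finite mindex. sum \<alpha> UNIV \<le> N}"
proof (rule finite_subset)
  show "{\<alpha>. sum \<alpha> UNIV \<le> N} \<subseteq> PiE (UNIV :: 'n set) (\<lambda>_. {..N})"
  proof
    fix \<alpha> :: "'n mindex" assume "\<alpha> \<in> {\<alpha>. sum \<alpha> UNIV \<le> N}"
    moreover have "\<alpha> j \<le> sum \<alpha> UNIV" for j by (rule member_le_sum) auto
    ultimately have "\<alpha> j \<le> N" for j using order_trans by blast
    then show "\<alpha> \<in> PiE UNIV (\<lambda>_. {..N})" by (simp add: PiE_UNIV_domain)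
  qed
  show "finite (PiE (UNIV :: 'n set) (\<lambda>_. {..N}))" by (rule finite_PiE) auto
qed

text \<open>This degree bound yields the pointwise finiteness of the Taylor series as well as of the
  substituted series.\<close>

lemma vanishes_support:
  fixes T :: "'n::{finite,linorder} mindex \<Rightarrow> 'n dfun"
  assumes "\<And>\<alpha>. vanishes (sum \<alpha> UNIV) (T \<alpha>)"
  shows "{\<alpha>. T \<alpha> x \<noteq> 0} \<subseteq> {\<alpha>. sum \<alpha> UNIV \<le> 2 * height x}"
  using vanishes_imp_eq_0[OF assms] by (auto simp: not_less[symmetric])

lemma vanishes_finite:
  fixes T :: "'n::{finite,linorder} mindex \<Rightarrow> 'n dfun"
  assumes "\<And>\<alpha>. vanishes (sum \<alpha> UNIV) (T \<alpha>)"
  shows "finite {\<alpha>. T \<alpha> x \<noteq> 0}"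
  by (rule finite_subset[OF vanishes_support[OF assms] finite_mindex])

lift_definition partial_l :: "'n::{finite,linorder} \<Rightarrow> 'n lop" is partial
proof (rule local_linearI)
  fix j :: 'n and x
  show "\<exists>Y. finite Y \<and> (\<forall>f. (\<forall>y\<in>Y. f y = 0) \<longrightarrow> partial j f x = 0)"
    by (intro exI[of _ "{x, x(j := x j + 1), x(j := x j - 1)}"])
       (simp add: partial_def fwd_diff_def bwd_diff_def)
qed (simp_all add: partial_add partial_mult_right)

section \<open>Ordered iterated derivatives at the origin\<close>

lemma anticommute_power:
  fixes a b :: "'a::ring_1"
  assumes "a * b = - (b * a)"
  shows "a * b ^ k = (- 1) ^ k * (b ^ k * a)"
proof (induction k)
  case (Suc k)
  have "a * b ^ Suc k = a * b * b ^ k" by (simp add: mult.assoc)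
  also have "\<dots> = - (b * (a * b ^ k))" by (simp add: assms mult.assoc)
  also have "\<dots> = (- 1) ^ Suc k * (b ^ Suc k * a)"
    by (simp add: Suc mult.assoc minus_one_power_iff)
  finally show ?case .
qed simp

lemma partial_l_anticommute:
  assumes "i \<noteq> j"
  shows "partial_l i * partial_l j = - (partial_l j * partial_l i)"
proof (rule lop_eqI)
  fix f
  have c: "x(i := a, j := b) = x(j := b, i := a)" for x :: "'a lattice" and a b
    using assms by (rule fun_upd_twist)
  have "partial i (partial j f) x = - partial j (partial i f) x" for x
    using assms assms[symmetric]
    by (simp add: partial_def fwd_diff_def bwd_diff_def c distrib_left right_diff_distrib
        mult.assoc[symmetric] e_anticommute[OF assms])
  then show "app (partial_l i * partial_l j) f = app (- (partial_l j * partial_l i)) f"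
    by (simp add: fun_eq_iff partial_l.rep_eq)
qed

text \<open>The list is reversed so that the derivative with the smallest index acts first. On
  \<xi>_1^{\<alpha>_1} ... \<xi>_m^{\<alpha>_m}[1] it strips the leading factor, and the top
  derivative is a factorial without sign.\<close>

definition partial_power :: "'n::{finite,linorder} mindex \<Rightarrow> 'n lop" where
  "partial_power \<beta> = prod_list (map (\<lambda>j. partial_l j ^ \<beta> j) (rev (sorted_list_of_set UNIV)))"

lemma partial_power_0: "partial_power (\<lambda>_. 0) = 1"
  by (simp add: partial_power_def prod_list_one)

text \<open>The additional derivative stands to the right of all others and has to pass precisely
  the powers with index below \<open>j\<close>.\<close>

lemma partial_power_mult:
  "partial_power \<beta> * partial_l j = (- 1) ^ (\<Sum>i<j. \<beta> i) * partial_power (\<beta>(j := \<beta> j + 1))"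
proof -
  obtain as bs where split: "sorted_list_of_set UNIV = as @ j # bs" "set as = {..<j}"
    "set bs = {j<..}" "distinct as" "distinct bs"
    by (rule sorted_list_split)
  define A where "A = prod_list (map (\<lambda>i. partial_l i ^ \<beta> i) (rev as))"
  define B where "B = prod_list (map (\<lambda>i. partial_l i ^ \<beta> i) (rev bs))"
  have cong_as: "map (\<lambda>i. partial_l i ^ (\<beta>(j := k)) i) (rev as) = map (\<lambda>i. partial_l i ^ \<beta> i) (rev as)"
    and cong_bs: "map (\<lambda>i. partial_l i ^ (\<beta>(j := k)) i) (rev bs) = map (\<lambda>i. partial_l i ^ \<beta> i) (rev bs)"
    for k
    using split by auto
  have P: "partial_power (\<beta>(j := k)) = B * (partial_l j ^ k * A)" for k
    unfolding partial_power_def split rev_append rev.simps map_append list.map prod_list.append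
      prod_list.Cons cong_as cong_bs
    by (simp add: A_def B_def mult.assoc)
  have s: "sum_list (map \<beta> (rev as)) = (\<Sum>i<j. \<beta> i)"
    using split by (simp add: sum_list_distinct_conv_sum_set)
  have "partial_l j * A = (- 1) ^ (\<Sum>i<j. \<beta> i) * (A * partial_l j)"
    unfolding A_def s[symmetric] using split
    by (intro anticommute_prod_list anticommute_power partial_l_anticommute) auto
  then have "A * partial_l j = (- 1) ^ (\<Sum>i<j. \<beta> i) * (partial_l j * A)"
    by (simp add: minus_one_power_iff)
  then have "B * (partial_l j ^ \<beta> j * (A * partial_l j))
      = (- 1) ^ (\<Sum>i<j. \<beta> i) * (B * (partial_l j ^ Suc (\<beta> j) * A))"
    by (simp add: mult.assoc minus_one_power_iff power_Suc2 del: power_Suc)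
  then show ?thesis using P[of "\<beta> j"] P[of "\<beta> j + 1"] by (simp add: mult.assoc)
qed

definition partial_at_0 :: "'n::{finite,linorder} mindex \<Rightarrow> 'n dfun \<Rightarrow> 'n clifford" where
  "partial_at_0 \<beta> f = app (partial_power \<beta>) f (\<lambda>_. 0)"

lemma partial_at_0_partial:
  "partial_at_0 \<beta> (partial j f) = (- 1) ^ (\<Sum>i<j. \<beta> i) * partial_at_0 (\<beta>(j := \<beta> j + 1)) f"
proof -
  have "partial_at_0 \<beta> (partial j f) = app (partial_power \<beta> * partial_l j) f (\<lambda>_. 0)"
    by (simp add: partial_at_0_def partial_l.rep_eq)
  then show ?thesis by (simp only: partial_power_mult app_sign partial_at_0_def)
qed

definition mfact :: "'n::finite mindex \<Rightarrow> nat" where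
  "mfact \<beta> = (\<Prod>j\<in>UNIV. fact (\<beta> j))"

lemma mfact_pos: "0 < mfact \<beta>"
  by (simp add: mfact_def prod_pos)

lemma mfact_Suc: "mfact (\<beta>(j := \<beta> j + 1)) = (\<beta> j + 1) * mfact \<beta>"
proof -
  have "(\<Prod>i\<in>UNIV - {j}. fact ((\<beta>(j := \<beta> j + 1)) i)) = (\<Prod>i\<in>UNIV - {j}. fact (\<beta> i) :: nat)"
    by (rule prod.cong) auto
  then show ?thesis
    by (simp add: mfact_def prod.remove[of UNIV j] algebra_simps)
qed

text \<open>Duality between ordered derivatives at 0 and basic polynomials, by which Taylor
  coefficients are read off. In the induction, the sign from reordering the derivatives cancels the
  one from differentiating the polynomial.\<close>

lemma partial_at_0_basic_term:
  "partial_at_0 \<beta> (basic_term \<alpha> c) = (if \<alpha> = \<beta> then of_nat (mfact \<beta>) * c else 0)"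
proof (induction "sum \<beta> UNIV" arbitrary: \<beta> \<alpha> c)
  case 0
  then have "\<beta> = (\<lambda>_. 0)" by auto
  then show ?case
    by (simp add: partial_at_0_def partial_power_0 basic_term_def basic_poly_0 basic_poly_at_0 mfact_def)
next
  case (Suc d)
  then obtain j where j: "\<beta> j > 0" by (metis gr0I old.nat.distinct(1) sum.neutral)
  define \<beta>' where "\<beta>' = \<beta>(j := \<beta> j - 1)"
  have \<beta>: "\<beta> = \<beta>'(j := \<beta>' j + 1)" using j by (auto simp: \<beta>'_def)
  have d: "d = sum \<beta>' UNIV"
    using Suc.hyps(2) j sum.remove[of UNIV j \<beta>] sum.remove[of UNIV j \<beta>'] by (simp add: \<beta>'_def)
  let ?s = "\<lambda>\<alpha> :: 'a mindex. (- 1) ^ (\<Sum>i<j. \<alpha> i) :: 'a clifford"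
  have ss: "?s \<gamma> * (?s \<gamma> * a) = a" for \<gamma> a
    by (simp add: minus_one_power_iff)
  have "partial_at_0 \<beta>' (partial j (basic_term \<alpha> c)) = ?s \<beta>' * partial_at_0 \<beta> (basic_term \<alpha> c)"
    unfolding \<beta> by (rule partial_at_0_partial)
  then have "partial_at_0 \<beta> (basic_term \<alpha> c) = ?s \<beta>' * partial_at_0 \<beta>' (partial j (basic_term \<alpha> c))"
    by (simp add: ss)
  also have "\<dots> = ?s \<beta>' * (if \<alpha>(j := \<alpha> j - 1) = \<beta>'
      then of_nat (mfact \<beta>') * (?s \<alpha> * of_nat (\<alpha> j) * c) else 0)"
    unfolding partial_basic_term Suc.hyps(1)[OF d] ..
  also have "\<dots> = (if \<alpha> = \<beta> then of_nat (mfact \<beta>) * c else 0)"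
  proof (cases "\<alpha> = \<beta>")
    case True
    moreover have "(\<Sum>i<j. \<beta> i) = (\<Sum>i<j. \<beta>' i)" by (rule sum.cong) (auto simp: \<beta>'_def)
    ultimately have "\<alpha>(j := \<alpha> j - 1) = \<beta>'" "?s \<alpha> = ?s \<beta>'" "\<alpha> j = \<beta>' j + 1"
      using j by (auto simp: \<beta>'_def)
    moreover have "?s \<beta>' * (of_nat (mfact \<beta>') * (?s \<beta>' * of_nat (\<beta>' j + 1) * c))
      = of_nat (mfact \<beta>') * (of_nat (\<beta>' j + 1) * c)"
      by (simp add: minus_one_power_iff mult.assoc)
    moreover have "of_nat (mfact \<beta>) = (of_nat (mfact \<beta>') * of_nat (\<beta>' j + 1) :: 'a clifford)"
      unfolding \<beta> mfact_Suc mult.commute[of _ "mfact \<beta>'"] by (rule of_nat_mult)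
    ultimately show ?thesis using True by (simp add: mult.assoc)
  next
    case False
    \<comment> \<open>Distinct indices can agree after lowering only through truncated subtraction;
      the derivative then carries the factor 0.\<close>
    then have "\<alpha> j = 0" if "\<alpha>(j := \<alpha> j - 1) = \<beta>'"
      using that \<beta> by (cases "\<alpha> j") (auto simp: fun_eq_iff split: if_splits)
    with False show ?thesis by auto
  qed
  finally show ?case .
qed

text \<open>\<open>vanishes\<close> takes derivatives in every order; by anticommutation each of
  them equals an ordered one up to sign.\<close>

lemma vanishes_if_partial_at_0:
  "(\<And>\<beta>. sum \<beta> UNIV < d \<Longrightarrow> partial_at_0 \<beta> f = 0) \<Longrightarrow> vanishes d f"
proof (induction d arbitrary: f)
  case (Suc d)
  have "f (\<lambda>_. 0) = partial_at_0 (\<lambda>_. 0) f" by (simp add: partial_at_0_def partial_power_0)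
  then have "f (\<lambda>_. 0) = 0" using Suc.prems[of "\<lambda>_. 0"] by simp
  moreover have "vanishes d (partial j f)" for j
  proof (rule Suc.IH)
    fix \<beta> :: "'a mindex" assume "sum \<beta> UNIV < d"
    then have "sum (\<beta>(j := \<beta> j + 1)) UNIV < Suc d"
      using sum.remove[of UNIV j \<beta>] sum.remove[of UNIV j "\<beta>(j := \<beta> j + 1)"] by simp
    then show "partial_at_0 \<beta> (partial j f) = 0"
      using Suc.prems by (simp add: partial_at_0_partial)
  qed
  ultimately show ?case by simp
qed simp

lemma of_nat_scaleR_cancel:
  "0 < n \<Longrightarrow> (1 / real n) *\<^sub>R (of_nat n * a) = (a :: 'a::real_algebra_1)"
  "0 < n \<Longrightarrow> of_nat n * ((1 / real n) *\<^sub>R a) = (a :: 'a::real_algebra_1)"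
proof -
  have "of_nat n * a = real n *\<^sub>R a" for a :: 'a by (simp add: scaleR_conv_of_real)
  then show "0 < n \<Longrightarrow> (1 / real n) *\<^sub>R (of_nat n * a) = a"
    "0 < n \<Longrightarrow> of_nat n * ((1 / real n) *\<^sub>R a) = a" by simp_all
qed

text \<open>No limit is involved: subtracting all terms of degree at most
  \<open>2 * height x\<close> leaves a remainder whose order of vanishing at 0 exceeds
  \<open>2 * height x\<close>, hence one that is zero at \<open>x\<close>.\<close>

lemma taylor_expansion:
  fixes f :: "'n::{finite,linorder} dfun"
  shows "f = series (\<lambda>\<alpha>. basic_term \<alpha> ((1 / real (mfact \<alpha>)) *\<^sub>R partial_at_0 \<alpha> f))"
proof
  fix x :: "'n lattice"
  let ?T = "\<lambda>\<alpha>. basic_term \<alpha> ((1 / real (mfact \<alpha>)) *\<^sub>R partial_at_0 \<alpha> f)"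
  define A :: "'n mindex set" where "A = {\<alpha>. sum \<alpha> UNIV \<le> 2 * height x}"
  have A: "finite A" unfolding A_def by (rule finite_mindex)
  have s: "series ?T x = (\<Sum>\<alpha>\<in>A. ?T \<alpha> x)"
    using A unfolding A_def by (intro series_eq_sum vanishes_support vanishes_basic_term)
  have "vanishes (Suc (2 * height x)) (\<lambda>x. f x - (\<Sum>\<alpha>\<in>A. ?T \<alpha> x))"
  proof (rule vanishes_if_partial_at_0)
    fix \<beta> :: "'n mindex" assume "sum \<beta> UNIV < Suc (2 * height x)"
    then have \<beta>: "\<beta> \<in> A" by (simp add: A_def)
    have "partial_at_0 \<beta> (\<lambda>x. f x - (\<Sum>\<alpha>\<in>A. ?T \<alpha> x))
        = partial_at_0 \<beta> f - (\<Sum>\<alpha>\<in>A. partial_at_0 \<beta> (?T \<alpha>))"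
      by (simp add: partial_at_0_def app_diff_right app_sum_right)
    also have "\<dots> = partial_at_0 \<beta> f - of_nat (mfact \<beta>) * ((1 / real (mfact \<beta>)) *\<^sub>R partial_at_0 \<beta> f)"
      using A \<beta> by (simp add: partial_at_0_basic_term sum.delta cong: if_cong)
    also have "\<dots> = 0"
      by (simp add: of_nat_scaleR_cancel mfact_pos)
    finally show "partial_at_0 \<beta> (\<lambda>x. f x - (\<Sum>\<alpha>\<in>A. ?T \<alpha> x)) = 0" .
  qed
  then have "f x - (\<Sum>\<alpha>\<in>A. ?T \<alpha> x) = 0" by (rule vanishes_imp_eq_0) simp
  then show "f x = series ?T x" by (simp add: s)
qed

lemma taylor_unique:
  fixes f :: "'n::{finite,linorder} dfun"
  assumes "f = series (\<lambda>\<alpha>. basic_term \<alpha> (c \<alpha>))"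
  shows "c \<beta> = (1 / real (mfact \<beta>)) *\<^sub>R partial_at_0 \<beta> f"
proof -
  obtain A0 where A0: "finite A0" "\<And>A. finite A \<Longrightarrow> A0 \<subseteq> A \<Longrightarrow>
     app (partial_power \<beta>) (series (\<lambda>\<alpha>. basic_term \<alpha> (c \<alpha>))) (\<lambda>_. 0)
       = (\<Sum>\<alpha>\<in>A. app (partial_power \<beta>) (basic_term \<alpha> (c \<alpha>)) (\<lambda>_. 0))"
    using app_series[where T = "\<lambda>\<alpha>. basic_term \<alpha> (c \<alpha>)" and L = "partial_power \<beta>"
          and x = "\<lambda>_. 0", OF vanishes_finite[OF vanishes_basic_term]] by blast
  \<comment> \<open>\<open>\<beta>\<close> is added to the index set to make sure that the one term
    with nonzero derivative is among those summed.\<close>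
  have "partial_at_0 \<beta> f = (\<Sum>\<alpha>\<in>insert \<beta> A0. partial_at_0 \<beta> (basic_term \<alpha> (c \<alpha>)))"
    using A0(2)[of "insert \<beta> A0"] A0(1) by (auto simp: partial_at_0_def assms)
  also have "\<dots> = of_nat (mfact \<beta>) * c \<beta>"
    using A0(1) by (simp add: partial_at_0_basic_term sum.delta cong: if_cong)
  finally show ?thesis
    by (simp add: of_nat_scaleR_cancel mfact_pos)
qed

lemma taylor_coeff_eq: "taylor_coeff f \<beta> = (1 / real (mfact \<beta>)) *\<^sub>R partial_at_0 \<beta> f"
proof -
  let ?c = "\<lambda>\<beta>. (1 / real (mfact \<beta>)) *\<^sub>R partial_at_0 \<beta> f"
  have "taylor_coeff f = ?c"
    unfolding taylor_coeff_def
  proof (rule the_equality)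
    show "f = series (\<lambda>\<alpha> x. basic_poly \<alpha> x * ?c \<alpha>)"
      using taylor_expansion[of f] by (simp add: basic_term_def)
    fix c assume "f = series (\<lambda>\<alpha> x. basic_poly \<alpha> x * c \<alpha>)"
    then have "f = series (\<lambda>\<alpha>. basic_term \<alpha> (c \<alpha>))" by (simp only: basic_term_def)
    then show "c = ?c" by - (rule ext, rule taylor_unique)
  qed
  then show ?thesis by simp
qed

lemma taylor_series: "f = series (\<lambda>\<alpha>. basic_term \<alpha> (taylor_coeff f \<alpha>))"
  unfolding taylor_coeff_eq by (rule taylor_expansion)

lemma taylor_coeff_basic_term: "taylor_coeff (basic_term \<alpha> c) \<beta> = (if \<alpha> = \<beta> then c else 0)"
  by (simp add: taylor_coeff_eq partial_at_0_basic_term of_nat_scaleR_cancel mfact_pos)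

lemma taylor_coeff_add: "taylor_coeff (\<lambda>x. f x + g x) \<beta> = taylor_coeff f \<beta> + taylor_coeff g \<beta>"
  by (simp add: taylor_coeff_eq partial_at_0_def app_add_right scaleR_right_distrib)

lemma taylor_coeff_mult_right: "taylor_coeff (\<lambda>x. f x * c) \<beta> = taylor_coeff f \<beta> * c"
  by (simp add: taylor_coeff_eq partial_at_0_def app_mult_right)

lemma lop_eq_on_basic_term:
  fixes L M :: "'n::{finite,linorder} lop"
  assumes "\<And>\<alpha> c. app L (basic_term \<alpha> c) = app M (basic_term \<alpha> c)"
  shows "L = M"
proof (rule lop_eqI, rule ext)
  fix f :: "'n dfun" and x :: "'n lattice"
  let ?T = "\<lambda>\<alpha>. basic_term \<alpha> (taylor_coeff f \<alpha>)"
  note fin = vanishes_finite[where T = ?T, OF vanishes_basic_term]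
  obtain A where A: "finite A"
      "\<And>B. finite B \<Longrightarrow> A \<subseteq> B \<Longrightarrow> app L (series ?T) x = (\<Sum>\<alpha>\<in>B. app L (?T \<alpha>) x)"
    using app_series[where T = ?T and L = L and x = x, OF fin] by blast
  obtain B where B: "finite B"
      "\<And>C. finite C \<Longrightarrow> B \<subseteq> C \<Longrightarrow> app M (series ?T) x = (\<Sum>\<alpha>\<in>C. app M (?T \<alpha>) x)"
    using app_series[where T = ?T and L = M and x = x, OF fin] by blast
  have "app L (series ?T) x = app M (series ?T) x"
    using A(2)[of "A \<union> B"] B(2)[of "A \<union> B"] A(1) B(1) assms by simp
  then show "app L f x = app M f x" by (simp only: taylor_series[of f, symmetric])
qed

section \<open>Operators given by their values on the basic polynomials\<close>

text \<open>The common shape of \<open>xi\<close>, \<open>R_op\<close> and, as a function of its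
  first argument, \<open>op_subst\<close>; locality is proved once for all three.\<close>

definition taylor_op :: "('n::{finite,linorder} mindex \<Rightarrow> 'n dfun) \<Rightarrow> 'n dop" where
  "taylor_op K f = series (\<lambda>\<alpha> x. K \<alpha> x * taylor_coeff f \<alpha>)"

text \<open>At a given point finitely many multi-indices contribute, and each Taylor coefficient is
  a derivative at 0, which sees finitely many values of the function.\<close>

lemma local_linear_taylor_op:
  assumes "\<And>x. finite {\<alpha>. K \<alpha> x \<noteq> 0}"
  shows "local_linear (taylor_op K)"
proof -
  have eq: "taylor_op K f x = (\<Sum>\<alpha>\<in>{\<alpha>. K \<alpha> x \<noteq> 0}. K \<alpha> x * taylor_coeff f \<alpha>)" for f x
    unfolding taylor_op_def by (rule series_eq_sum[OF assms]) auto
  show ?thesis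
  proof (rule local_linearI)
    fix x
    obtain Y :: "'a mindex \<Rightarrow> 'a lattice set" where Y: "\<And>\<alpha>. finite (Y \<alpha>)"
      "\<And>\<alpha> f. \<forall>y\<in>Y \<alpha>. f y = 0 \<Longrightarrow> app (partial_power \<alpha>) f (\<lambda>_. 0) = 0"
      using app_local[of "partial_power _" "\<lambda>_. 0"] by metis
    show "\<exists>Y. finite Y \<and> (\<forall>f. (\<forall>y\<in>Y. f y = 0) \<longrightarrow> taylor_op K f x = 0)"
    proof (intro exI conjI allI impI)
      show "finite (\<Union>\<alpha>\<in>{\<alpha>. K \<alpha> x \<noteq> 0}. Y \<alpha>)" using assms Y(1) by auto
      fix f :: "'a dfun" assume "\<forall>y\<in>\<Union>\<alpha>\<in>{\<alpha>. K \<alpha> x \<noteq> 0}. Y \<alpha>. f y = 0"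
      then have "taylor_coeff f \<alpha> = 0" if "K \<alpha> x \<noteq> 0" for \<alpha>
        using that Y(2)[of \<alpha> f] by (auto simp: taylor_coeff_eq partial_at_0_def)
      then show "taylor_op K f x = 0" unfolding eq by (intro sum.neutral) auto
    qed
  qed (simp_all add: eq taylor_coeff_add taylor_coeff_mult_right distrib_left sum.distrib
      sum_distrib_right mult.assoc)
qed

lemma taylor_op_basic_term: "taylor_op K (basic_term \<alpha> c) = (\<lambda>x. K \<alpha> x * c)"
proof
  fix x
  have "taylor_op K (basic_term \<alpha> c) x = (\<Sum>\<beta>\<in>{\<alpha>}. K \<beta> x * taylor_coeff (basic_term \<alpha> c) \<beta>)"
    unfolding taylor_op_def by (rule series_eq_sum) (auto simp: taylor_coeff_basic_term)
  then show "taylor_op K (basic_term \<alpha> c) x = K \<alpha> x * c" by (simp add: taylor_coeff_basic_term)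
qed

lemma finite_basic_poly: "finite {\<alpha>. basic_poly \<alpha> x \<noteq> 0}"
  using vanishes_finite[of "\<lambda>\<alpha>. basic_term \<alpha> 1" x, OF vanishes_basic_term]
  by (simp add: basic_term_def)

lift_definition xi_l :: "'n::{finite,linorder} \<Rightarrow> 'n lop" is xi
proof -
  fix j :: 'n
  define K where "K = (\<lambda>(\<alpha> :: 'n mindex) x. (- 1) ^ (\<Sum>i<j. \<alpha> i) * basic_poly (\<alpha>(j := \<alpha> j + 1)) x)"
  have "finite {\<alpha>. K \<alpha> x \<noteq> 0}" for x
  proof (rule inj_on_finite)
    show "inj_on (\<lambda>\<alpha>. \<alpha>(j := \<alpha> j + 1)) {\<alpha>. K \<alpha> x \<noteq> 0}"
      by (rule inj_onI) (auto simp: fun_eq_iff split: if_splits)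
    show "(\<lambda>\<alpha>. \<alpha>(j := \<alpha> j + 1)) ` {\<alpha>. K \<alpha> x \<noteq> 0} \<subseteq> {\<alpha>. basic_poly \<alpha> x \<noteq> 0}"
      by (auto simp: K_def)
  qed (rule finite_basic_poly)
  moreover have "xi j = taylor_op K" by (simp add: fun_eq_iff xi_def taylor_op_def K_def)
  ultimately show "local_linear (xi j)" by (simp add: local_linear_taylor_op)
qed

lift_definition R_l :: "'n::{finite,linorder} \<Rightarrow> 'n lop" is R_op
proof -
  fix j :: 'n
  define K where "K = (\<lambda>(\<alpha> :: 'n mindex) x. (- 1) ^ (\<Sum>i\<in>UNIV - {j}. \<alpha> i) * basic_poly \<alpha> x * e_vec j)"
  have "finite {\<alpha>. K \<alpha> x \<noteq> 0}" for x
    by (rule finite_subset[OF _ finite_basic_poly[of x]]) (auto simp: K_def)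
  moreover have "R_op j = taylor_op K" by (simp add: fun_eq_iff R_op_def taylor_op_def K_def)
  ultimately show "local_linear (R_op j)" by (simp add: local_linear_taylor_op)
qed

lemma xi_basic_term: "xi j (basic_term \<alpha> c) = basic_term (\<alpha>(j := \<alpha> j + 1)) ((- 1) ^ (\<Sum>i<j. \<alpha> i) * c)"
  using taylor_op_basic_term[of "\<lambda>\<alpha> x. (- 1) ^ (\<Sum>i<j. \<alpha> i) * basic_poly (\<alpha>(j := \<alpha> j + 1)) x" \<alpha> c]
  by (simp add: taylor_op_def xi_def basic_term_def minus_one_power_iff)

lemma R_op_basic_term: "R_op j (basic_term \<alpha> c) = basic_term \<alpha> ((- 1) ^ (\<Sum>i\<in>UNIV - {j}. \<alpha> i) * e_vec j * c)"
  using taylor_op_basic_term[of "\<lambda>\<alpha> x. (- 1) ^ (\<Sum>i\<in>UNIV - {j}. \<alpha> i) * basic_poly \<alpha> x * e_vec j" \<alpha> c]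
  by (simp add: taylor_op_def R_op_def basic_term_def minus_one_power_iff mult.assoc)

section \<open>Relations between the operators\<close>

text \<open>Signs are taken real, so that they act by \<open>scaleR\<close> and can be moved past
  noncommuting Clifford elements.\<close>

definition sign :: "'n set \<Rightarrow> 'n mindex \<Rightarrow> real" where
  "sign A \<alpha> = (- 1) ^ sum \<alpha> A"

lemma sign_mult_self [simp]: "sign A \<alpha> * sign A \<alpha> = 1" "sign A \<alpha> * (sign A \<alpha> * r) = r"
  by (simp_all add: sign_def minus_one_power_iff)

lemma sign_upd_Suc: "finite A \<Longrightarrow> sign A (\<alpha>(k := Suc (\<alpha> k))) = (if k \<in> A then - sign A \<alpha> else sign A \<alpha>)"
proof (cases "k \<in> A")
  case True
  assume "finite A"
  moreover have "sum (\<alpha>(k := Suc (\<alpha> k))) (A - {k}) = sum \<alpha> (A - {k})"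
    by (rule sum.cong) auto
  ultimately have "sum (\<alpha>(k := Suc (\<alpha> k))) A = Suc (sum \<alpha> A)"
    using True by (simp add: sum.remove[of A k])
  with True show ?thesis by (simp add: sign_def)
next
  case False
  then have "sum (\<alpha>(k := Suc (\<alpha> k))) A = sum \<alpha> A" by (intro sum.cong) auto
  with False show ?thesis by (simp add: sign_def)
qed

lemma sign_upd_pred:
  assumes "finite A" "\<alpha> k = Suc n"
  shows "sign A (\<alpha>(k := n)) = (if k \<in> A then - sign A \<alpha> else sign A \<alpha>)"
  using sign_upd_Suc[of A "\<alpha>(k := n)" k] assms fun_upd_triv[of \<alpha> k] by (simp split: if_splits)

lemma sign_upd_notin: "k \<notin> A \<Longrightarrow> sign A (\<alpha>(k := n)) = sign A \<alpha>"
  unfolding sign_def by (metis (mono_tags, lifting) fun_upd_other sum.cong)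

lemma minus_one_scaleR: "(- 1) ^ k * c = ((- 1) ^ k :: real) *\<^sub>R (c :: 'n::{finite,linorder} clifford)"
  by (simp add: minus_one_power_iff)

lemma of_nat_scaleR: "of_nat n * c = real n *\<^sub>R (c :: 'n::{finite,linorder} clifford)"
  by (simp add: scaleR_conv_of_real)

lemma partial_l_basic_term:
  "app (partial_l j) (basic_term \<alpha> c)
     = basic_term (\<alpha>(j := \<alpha> j - 1)) ((sign {..<j} \<alpha> * real (\<alpha> j)) *\<^sub>R c)"
  by (simp add: partial_l.rep_eq partial_basic_term minus_one_scaleR of_nat_scaleR sign_def)

lemma xi_l_basic_term:
  "app (xi_l j) (basic_term \<alpha> c) = basic_term (\<alpha>(j := Suc (\<alpha> j))) (sign {..<j} \<alpha> *\<^sub>R c)"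
  by (simp add: xi_l.rep_eq xi_basic_term minus_one_scaleR sign_def)

lemma R_l_basic_term:
  "app (R_l j) (basic_term \<alpha> c) = basic_term \<alpha> (sign (UNIV - {j}) \<alpha> *\<^sub>R (e_vec j * c))"
  by (simp add: R_l.rep_eq R_op_basic_term minus_one_scaleR sign_def)

lemmas op_basic_term = partial_l_basic_term xi_l_basic_term R_l_basic_term

lemma R_l_square: "R_l j * R_l j = 1"
  by (rule lop_eq_on_basic_term) (simp add: op_basic_term mult.assoc[symmetric] e_vec_square)

lemma e_vec_anticommute_left: "i \<noteq> j \<Longrightarrow> e_vec i * (e_vec j * c) = - (e_vec j * (e_vec i * c))"
  by (simp add: mult.assoc[symmetric] e_vec_anticommute[of i j])

lemma R_l_anticommute: "i \<noteq> j \<Longrightarrow> R_l i * R_l j = - (R_l j * R_l i)"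
  by (rule lop_eq_on_basic_term)
    (simp add: fun_eq_iff op_basic_term basic_term_minus e_vec_anticommute_left[of i j] mult.commute)

text \<open>Raising \<alpha>_j changes the sign in \<open>R_l i\<close> exactly when
  \<open>j\<close> belongs to \<open>UNIV - {i}\<close>.\<close>

lemma R_l_xi_l: "R_l i * xi_l j = (if i = j then xi_l j * R_l i else - (xi_l j * R_l i))"
  by (rule lop_eq_on_basic_term)
    (simp add: fun_eq_iff op_basic_term sign_upd_Suc basic_term_minus mult.commute)

lemma R_l_partial_l: "R_l i * partial_l j = (if i = j then partial_l j * R_l i else - (partial_l j * R_l i))"
proof (rule lop_eq_on_basic_term)
  fix \<alpha> c
  show "app (R_l i * partial_l j) (basic_term \<alpha> c)
    = app (if i = j then partial_l j * R_l i else - (partial_l j * R_l i)) (basic_term \<alpha> c)"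
    by (cases "\<alpha> j")
      (simp_all add: fun_eq_iff op_basic_term sign_upd_pred basic_term_minus mult_ac app_zero_right)
qed

lemma partial_l_xi_l: "i \<noteq> j \<Longrightarrow> partial_l i * xi_l j = - (xi_l j * partial_l i)"
proof (rule lop_eq_on_basic_term)
  fix \<alpha> c assume "i \<noteq> j"
  then show "app (partial_l i * xi_l j) (basic_term \<alpha> c) = app (- (xi_l j * partial_l i)) (basic_term \<alpha> c)"
    by (cases "\<alpha> i"; cases i j rule: linorder_cases)
      (simp_all add: fun_eq_iff op_basic_term sign_upd_pred sign_upd_Suc basic_term_minus mult_ac
        fun_upd_twist[of i j] app_zero_right less_not_sym)
qed

lemma partial_l_xi_l_same: "partial_l j * xi_l j = xi_l j * partial_l j + 1"
proof (rule lop_eq_on_basic_term)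
  fix \<alpha> c
  show "app (partial_l j * xi_l j) (basic_term \<alpha> c) = app (xi_l j * partial_l j + 1) (basic_term \<alpha> c)"
  \<comment> \<open>The commutator acts as 1 - 0 if \<open>\<alpha> j = 0\<close>, and as (n + 2) -
    (n + 1) if \<open>\<alpha> j = Suc n\<close>.\<close>
  proof (cases "\<alpha> j")
    case 0
    then have "\<alpha>(j := 0) = \<alpha>" by (metis fun_upd_triv)
    with 0 show ?thesis
      by (intro ext) (simp add: op_basic_term sign_upd_notin app_zero_right)
  next
    case (Suc n)
    then have "\<alpha>(j := Suc n) = \<alpha>" by (metis fun_upd_triv)
    then show ?thesis using Suc
      by (intro ext) (simp add: op_basic_term sign_upd_notin, simp add: basic_term_def algebra_simps scaleR_2)
  qed
qed

text \<open>The products \<open>\<xi>_k R_k\<close> and \<open>\<partial>_k R_k\<close> commute with all \<open>R_j\<close> and satisfy the Weyl relations: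
  they play the roles of a classical coordinate and its partial derivative.\<close>

definition X_l :: "'n::{finite,linorder} \<Rightarrow> 'n lop" where "X_l k = xi_l k * R_l k"
definition D_l :: "'n::{finite,linorder} \<Rightarrow> 'n lop" where "D_l k = partial_l k * R_l k"

lemma commute_left: "a * b = b * a \<Longrightarrow> a * (b * c) = b * (a * c)"
  for a b c :: "'a::ring_1"
  by (metis mult.assoc)

lemma anticommute_left: "a * b = - (b * a) \<Longrightarrow> a * (b * c) = - (b * (a * c))"
  for a b c :: "'a::ring_1"
  by (metis mult.assoc mult_minus_left)

text \<open>For distinct indices \<open>R_l j\<close> anticommutes with both factors of
  \<open>X_l k\<close> and the two signs cancel; for equal indices it commutes with both.\<close>

lemma R_l_X_l: "R_l j * X_l k = X_l k * R_l j"
proof (cases "j = k")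
  case True
  have c: "R_l k * xi_l k = xi_l k * R_l k" by (simp add: R_l_xi_l)
  show ?thesis unfolding True by (simp add: X_l_def mult.assoc commute_left[OF c])
next
  case False
  then have a: "R_l j * xi_l k = - (xi_l k * R_l j)" by (simp add: R_l_xi_l)
  show ?thesis
    by (simp add: X_l_def mult.assoc anticommute_left[OF a] R_l_anticommute[OF False])
qed

lemma R_l_D_l: "R_l j * D_l k = D_l k * R_l j"
proof (cases "j = k")
  case True
  have c: "R_l k * partial_l k = partial_l k * R_l k" by (simp add: R_l_partial_l)
  show ?thesis unfolding True by (simp add: D_l_def mult.assoc commute_left[OF c])
next
  case False
  then have a: "R_l j * partial_l k = - (partial_l k * R_l j)" by (simp add: R_l_partial_l)
  show ?thesis
    by (simp add: D_l_def mult.assoc anticommute_left[OF a] R_l_anticommute[OF False])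
qed

text \<open>For distinct indices each factor of one operator anticommutes with each factor of the
  other, which makes four signs. For equal indices \<open>R_l j\<close> squares away and the
  relation of \<open>partial_l j\<close> and \<open>xi_l j\<close> remains.\<close>

lemma D_l_X_l: "D_l i * X_l j = X_l j * D_l i + (if i = j then 1 else 0)"
proof (cases "i = j")
  case True
  have c: "R_l j * xi_l j = xi_l j * R_l j" "R_l j * partial_l j = partial_l j * R_l j"
    by (simp_all add: R_l_xi_l R_l_partial_l)
  have "D_l j * X_l j = partial_l j * xi_l j"
    by (simp add: D_l_def X_l_def mult.assoc commute_left[OF c(1)] R_l_square)
  moreover have "X_l j * D_l j = xi_l j * partial_l j"
    by (simp add: D_l_def X_l_def mult.assoc commute_left[OF c(2)] R_l_square)
  ultimately show ?thesis using True by (simp add: partial_l_xi_l_same)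
next
  case False
  then have a: "R_l i * xi_l j = - (xi_l j * R_l i)" "R_l j * partial_l i = - (partial_l i * R_l j)"
    by (auto simp: R_l_xi_l R_l_partial_l)
  show ?thesis using False
    by (simp add: D_l_def X_l_def mult.assoc anticommute_left[OF a(1)] anticommute_left[OF a(2)]
        anticommute_left[OF partial_l_xi_l[OF False]] R_l_anticommute[OF False])
qed

lemma xi_l_eq: "xi_l k = X_l k * R_l k"
  by (simp add: X_l_def mult.assoc R_l_square)

lemma partial_l_eq: "partial_l k = D_l k * R_l k"
  by (simp add: D_l_def mult.assoc R_l_square)

lemma basic_term_0: "basic_term (\<lambda>_. 0) c = (\<lambda>_. c)"
  by (simp add: basic_term_def basic_poly_0)

lemma R_l_const: "app (R_l j) (\<lambda>_. c) = (\<lambda>_. e_vec j * c)"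
  using R_l_basic_term[of j "\<lambda>_. 0" c] by (simp add: basic_term_0 sign_def)

lemma app_const: "app L (\<lambda>_. 1) = (\<lambda>_. A) \<Longrightarrow> app L (\<lambda>_. c) = (\<lambda>_. A * c)"
  using app_mult_right[of L "\<lambda>_. 1" c] by simp

section \<open>The conjugation\<close>

text \<open>An operator commuting with the \<open>\<xi>_k R_k\<close> is determined by its value at the constant \<open>1\<close>;
  on these values the conjugation is induced by the anti-automorphism \<open>e_j^\<plusminus> \<mapsto> - e_j^\<plusminus>\<close> of the
  Clifford algebra.\<close>

lemma X_commuting_eq_0:
  assumes comm: "\<And>k. L * X_l k = X_l k * L" and 1: "app L (\<lambda>_. 1) = (\<lambda>_. 0)"
  shows "L = 0"
proof (rule lop_eq_on_basic_term)
  fix \<alpha> c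
  have "app L (basic_term \<alpha> c) = (\<lambda>_. 0)"
  proof (induction "sum \<alpha> UNIV" arbitrary: \<alpha> c)
    case 0
    then have "\<alpha> = (\<lambda>_. 0)" by auto
    then show ?case using app_const[OF 1] by (simp add: basic_term_0)
  next
    case (Suc d)
    then obtain j where "\<alpha> j > 0" by (metis gr0I old.nat.distinct(1) sum.neutral)
    then obtain n where n: "\<alpha> j = Suc n" by (cases "\<alpha> j") auto
    define \<beta> where "\<beta> = \<alpha>(j := n)"
    have \<alpha>: "\<alpha> = \<beta>(j := Suc (\<beta> j))" using n by (auto simp: \<beta>_def)
    have d: "d = sum \<beta> UNIV"
      using Suc.hyps(2) n sum.remove[of UNIV j \<alpha>] sum.remove[of UNIV j \<beta>] by (simp add: \<beta>_def)
    \<comment> \<open>Every basic polynomial of positive degree is in the range of some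
      \<open>xi_l j\<close>, that is, \<open>X_l j\<close> after \<open>R_l j\<close>; as
      \<open>R_l j\<close> only changes the coefficient, it is \<open>X_l j\<close> of a term of
      lower degree.\<close>
    have "basic_term \<alpha> c = app (xi_l j) (basic_term \<beta> (sign {..<j} \<beta> *\<^sub>R c))"
      by (simp add: xi_l_basic_term \<alpha>)
    then obtain c' where "basic_term \<alpha> c = app (X_l j) (basic_term \<beta> c')"
      by (simp add: xi_l_eq R_l_basic_term)
    then have "app L (basic_term \<alpha> c) = app (L * X_l j) (basic_term \<beta> c')" by simp
    also have "\<dots> = (\<lambda>_. 0)" by (simp add: comm Suc.hyps(1)[OF d] app_zero_right)
    finally show ?case .
  qed
  then show "app L (basic_term \<alpha> c) = app 0 (basic_term \<alpha> c)" by (simp add: fun_eq_iff)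
qed

section \<open>The anti-automorphism of the Clifford algebra\<close>

definition free_conj :: "'n free_alg \<Rightarrow> 'n free_alg" where
  "free_conj p = (\<Sum>w\<in>Poly_Mapping.keys p.
     Poly_Mapping.single (Mon (rev (letters w))) ((- 1) ^ length (letters w) * Poly_Mapping.lookup p w))"

lemma free_conj_superset:
  "finite S \<Longrightarrow> Poly_Mapping.keys p \<subseteq> S \<Longrightarrow> free_conj p = (\<Sum>w\<in>S.
     Poly_Mapping.single (Mon (rev (letters w))) ((- 1) ^ length (letters w) * Poly_Mapping.lookup p w))"
  unfolding free_conj_def by (rule sum.mono_neutral_left) (auto simp: in_keys_iff)

lemma free_conj_add: "free_conj (p + q) = free_conj p + free_conj q"
proof -
  let ?S = "Poly_Mapping.keys p \<union> Poly_Mapping.keys q"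
  note sup = free_conj_superset[of ?S]
  have "Poly_Mapping.keys (p + q) \<subseteq> ?S" by (rule Poly_Mapping.keys_add)
  then show ?thesis
    by (simp add: sup lookup_add distrib_left single_add sum.distrib)
qed

lemma free_conj_single:
  "free_conj (Poly_Mapping.single w c)
     = Poly_Mapping.single (Mon (rev (letters w))) ((- 1) ^ length (letters w) * c)"
  by (cases "c = 0") (auto simp: free_conj_def)

lemma free_conj_mult: "free_conj (p * q) = free_conj q * free_conj p"
proof (induction p rule: free_alg_induct)
  case (single u c)
  show ?case
  proof (induction q rule: free_alg_induct)
    case (single v d)
    then show ?case
      by (simp add: mult_single free_conj_single plus_free_mon_def power_add mult_ac)
  next
    case (add q r)
    then show ?case by (simp add: distrib_left distrib_right free_conj_add)
  qed
next
  case (add p r)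
  then show ?case by (simp add: distrib_left distrib_right free_conj_add)
qed

lemma free_conj_const: "free_conj (Poly_Mapping.single 0 c) = Poly_Mapping.single 0 c"
  by (simp add: free_conj_single zero_free_mon_def)

lemma free_conj_one: "free_conj 1 = 1"
  using free_conj_const[of 1] by (simp add: single_one)

lemma free_conj_zero: "free_conj 0 = 0"
  by (simp add: free_conj_def)

lemma free_conj_gen: "free_conj (gen a) = - gen a"
  by (simp add: gen_def free_conj_single single_uminus)

lemma free_conj_diff: "free_conj (p - q) = free_conj p - free_conj q"
  using free_conj_add[of "p - q" q] by (simp add: algebra_simps)

text \<open>In a product of two generators the signs cancel, and reversal exchanges the two summands
  of an anticommutator, so relators go to relators and the map descends to the quotient.\<close>

lemma free_conj_relator:
  assumes "r \<in> witt_relators"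
  shows "free_conj r \<in> witt_ideal"
  using assms
proof cases
  case (1 j k)
  have "free_conj r = gen (Plus k) * gen (Plus j) + gen (Plus j) * gen (Plus k)"
    by (simp add: 1 free_conj_add free_conj_mult free_conj_gen)
  then show ?thesis by (simp add: witt_ideal.relator witt_relators.intros)
next
  case (2 j k)
  have "free_conj r = gen (Minus k) * gen (Minus j) + gen (Minus j) * gen (Minus k)"
    by (simp add: 2 free_conj_add free_conj_mult free_conj_gen)
  then show ?thesis by (simp add: witt_ideal.relator witt_relators.intros)
next
  case (3 j k)
  have "free_conj r = r"
    by (simp add: 3 free_conj_diff free_conj_add free_conj_mult free_conj_gen free_conj_one
        free_conj_zero add.commute)
  with assms show ?thesis by (simp add: witt_ideal.relator)
qed

lemma free_conj_ideal: "p \<in> witt_ideal \<Longrightarrow> free_conj p \<in> witt_ideal"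
  by (induction rule: witt_ideal.induct)
    (auto simp: free_conj_zero free_conj_relator free_conj_add free_conj_mult intro: witt_ideal.intros)

lift_definition cl_conj :: "'n clifford \<Rightarrow> 'n clifford" is free_conj
  by (simp add: witt_equiv_def free_conj_ideal flip: free_conj_diff)

lemma cl_conj_add: "cl_conj (a + b) = cl_conj a + cl_conj (b :: 'n::{finite,linorder} clifford)"
  by transfer (simp add: free_conj_add witt_equiv_def witt_ideal.zero)

lemma cl_conj_mult: "cl_conj (a * b) = cl_conj b * cl_conj (a :: 'n::{finite,linorder} clifford)"
  by transfer (simp add: free_conj_mult witt_equiv_def witt_ideal.zero)

lemma cl_conj_one: "cl_conj 1 = (1 :: 'n::{finite,linorder} clifford)"
  by transfer (simp add: free_conj_one witt_equiv_def witt_ideal.zero)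

lemma cl_conj_complex: "cl_conj (clifford_of_complex c) = clifford_of_complex c"
  by transfer (simp add: free_conj_const witt_equiv_def witt_ideal.zero)

lemma cl_conj_scaleR: "cl_conj (r *\<^sub>R a) = r *\<^sub>R cl_conj (a :: 'n::{finite,linorder} clifford)"
  by (simp add: scaleR_clifford_def cl_conj_mult cl_conj_complex clifford_of_complex_central)

lemma cl_conj_e_plus: "cl_conj (e_plus j) = - e_plus (j :: 'n::{finite,linorder})"
  by transfer (simp add: free_conj_gen witt_equiv_def witt_ideal.zero)

lemma cl_conj_e_minus: "cl_conj (e_minus j) = - e_minus (j :: 'n::{finite,linorder})"
  by transfer (simp add: free_conj_gen witt_equiv_def witt_ideal.zero)

lemma cl_conj_e_vec: "cl_conj (e_vec j) = - e_vec j"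
  by (simp add: e_vec_def cl_conj_add cl_conj_e_plus cl_conj_e_minus)

section \<open>Single-valuedness of the conjugation\<close>

definition X_commuting :: "'n::{finite,linorder} lop \<Rightarrow> bool" where
  "X_commuting L \<longleftrightarrow> (\<forall>k. L * X_l k = X_l k * L)"

lemma X_commuting_intros:
  "X_commuting 1" "X_commuting (R_l j)"
  "X_commuting A \<Longrightarrow> X_commuting (- A)"
  "X_commuting A \<Longrightarrow> X_commuting (r *\<^sub>R A)"
  "X_commuting A \<Longrightarrow> X_commuting B \<Longrightarrow> X_commuting (A + B)"
  "X_commuting A \<Longrightarrow> X_commuting B \<Longrightarrow> X_commuting (A - B)"
  "X_commuting A \<Longrightarrow> X_commuting B \<Longrightarrow> X_commuting (A * B)"
proof -
  assume "X_commuting A" "X_commuting B"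
  then have A: "A * X_l k = X_l k * A" and B: "B * X_l k = X_l k * B" for k
    by (auto simp: X_commuting_def)
  have "A * B * X_l k = X_l k * (A * B)" for k
    using commute_left[OF A, of k B] by (simp add: mult.assoc B)
  then show "X_commuting (A * B)" by (simp add: X_commuting_def)
qed (simp_all add: X_commuting_def R_l_X_l distrib_left distrib_right left_diff_distrib right_diff_distrib)

lemma app_times: "app (A * B) = app A \<circ> app B"
  by (simp add: fun_eq_iff)

text \<open>The invariant that determines both sides of the graph. In the product case the values at
  1 are \<open>A * A'\<close> and \<open>cl_conj A' * cl_conj A\<close>, which match because
  \<open>cl_conj\<close> reverses products.\<close>

lemma conj_graph_lop:
  assumes "conj_graph a b"
  shows "\<exists>L M A. a = app L \<and> b = app M \<and> X_commuting L \<and> X_commuting M \<and>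
    app L (\<lambda>_. 1) = (\<lambda>_. A) \<and> app M (\<lambda>_. 1) = (\<lambda>_. cl_conj A)"
  using assms
proof induction
  case 1
  show ?case
    by (rule exI[of _ 1], rule exI[of _ 1], rule exI[of _ 1])
       (simp add: fun_eq_iff X_commuting_intros cl_conj_one)
next
  case (2 j)
  show ?case
    by (rule exI[of _ "R_l j"], rule exI[of _ "- R_l j"], rule exI[of _ "e_vec j"])
       (simp add: fun_eq_iff X_commuting_intros cl_conj_e_vec R_l.rep_eq[symmetric] R_l_const)
next
  case (3 a a' r)
  then obtain L M A where "a = app L" "a' = app M" "X_commuting L" "X_commuting M"
    "app L (\<lambda>_. 1) = (\<lambda>_. A)" "app M (\<lambda>_. 1) = (\<lambda>_. cl_conj A)" by blast
  then show ?case
    by (intro exI[of _ "r *\<^sub>R L"] exI[of _ "r *\<^sub>R M"] exI[of _ "r *\<^sub>R A"])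
       (simp add: fun_eq_iff X_commuting_intros cl_conj_scaleR)
next
  case (4 a a' b b')
  then obtain L M A L' M' A' where "a = app L" "a' = app M" "X_commuting L" "X_commuting M"
    "app L (\<lambda>_. 1) = (\<lambda>_. A)" "app M (\<lambda>_. 1) = (\<lambda>_. cl_conj A)"
    "b = app L'" "b' = app M'" "X_commuting L'" "X_commuting M'"
    "app L' (\<lambda>_. 1) = (\<lambda>_. A')" "app M' (\<lambda>_. 1) = (\<lambda>_. cl_conj A')" by blast
  then show ?case
    by (intro exI[of _ "L + L'"] exI[of _ "M + M'"] exI[of _ "A + A'"])
       (simp add: fun_eq_iff X_commuting_intros cl_conj_add)
next
  case (5 a a' b b')
  then obtain L M A L' M' A' where "a = app L" "a' = app M" "X_commuting L" "X_commuting M"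
    "app L (\<lambda>_. 1) = (\<lambda>_. A)" "app M (\<lambda>_. 1) = (\<lambda>_. cl_conj A)"
    "b = app L'" "b' = app M'" "X_commuting L'" "X_commuting M'"
    "app L' (\<lambda>_. 1) = (\<lambda>_. A')" "app M' (\<lambda>_. 1) = (\<lambda>_. cl_conj A')" by blast
  then show ?case
    by (intro exI[of _ "L * L'"] exI[of _ "M' * M"] exI[of _ "A * A'"] conjI)
       (simp_all add: app_times X_commuting_intros cl_conj_mult app_const)
qed

text \<open>The operator \<open>a\<close> fixes its value at 1, hence the value at 1 of any
  conjugate; two conjugates then differ by an operator that commutes with all \<open>X_l k\<close>
  and kills 1.\<close>

lemma conj_graph_unique:
  assumes "conj_graph a b" "conj_graph a c"
  shows "b = c"
proof -
  obtain L M A where L: "a = app L" "b = app M" "X_commuting M"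
    "app L (\<lambda>_. 1) = (\<lambda>_. A)" "app M (\<lambda>_. 1) = (\<lambda>_. cl_conj A)"
    using conj_graph_lop[OF assms(1)] by blast
  obtain L' M' A' where L': "a = app L'" "c = app M'" "X_commuting M'"
    "app L' (\<lambda>_. 1) = (\<lambda>_. A')" "app M' (\<lambda>_. 1) = (\<lambda>_. cl_conj A')"
    using conj_graph_lop[OF assms(2)] by blast
  have "A = A'" using L(1,4) L'(1,4) by (metis)
  then have "app (M - M') (\<lambda>_. 1) = (\<lambda>_. 0)" by (simp add: fun_eq_iff L(5) L'(5))
  moreover have "X_commuting (M - M')" using L(3) L'(3) by (rule X_commuting_intros)
  ultimately have "M - M' = 0" by (intro X_commuting_eq_0) (auto simp: X_commuting_def)
  then show ?thesis by (simp add: L(2) L'(2))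
qed

lemma op_conj_eq: "conj_graph a b \<Longrightarrow> op_conj a = b"
  unfolding op_conj_def by (rule the_equality) (auto intro: conj_graph_unique)

definition R_vec_l :: "('n::{finite,linorder} \<Rightarrow> real) \<Rightarrow> 'n lop" where
  "R_vec_l w = (\<Sum>j\<in>UNIV. w j *\<^sub>R R_l j)"

lemma app_R_vec_l: "app (R_vec_l w) = R_vec w"
  by (simp add: fun_eq_iff R_vec_l_def R_vec_def app_sum_left R_l.rep_eq)

lemma conj_graph_R_vec: "conj_graph (R_vec w) (app (- R_vec_l w))"
proof -
  have "conj_graph (\<lambda>f x. \<Sum>j\<in>J. w j *\<^sub>R R_op j f x) (\<lambda>f x. \<Sum>j\<in>J. w j *\<^sub>R - R_op j f x)"
    if "finite J" for J
    using that
  proof induction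
    case empty
    \<comment> \<open>The empty sum enters the graph as 0 times the identity.\<close>
    have "conj_graph (\<lambda>f x. 0 *\<^sub>R id f x) (\<lambda>f x. 0 *\<^sub>R id f x)"
      by (intro conj_graph.intros(3) conj_graph.intros(1))
    then show ?case by (simp only: scaleR_zero_left sum.empty)
  next
    case (insert j J)
    have "conj_graph (\<lambda>f x. w j *\<^sub>R R_op j f x) (\<lambda>f x. w j *\<^sub>R - R_op j f x)"
      by (intro conj_graph.intros(3) conj_graph.intros(2))
    from conj_graph.intros(4)[OF this insert.IH] show ?case
      by (simp only: sum.insert[OF insert.hyps])
  qed
  from this[of UNIV] have "conj_graph (R_vec w) (\<lambda>f x. \<Sum>j\<in>UNIV. w j *\<^sub>R - R_op j f x)"
    by (simp add: R_vec_def[abs_def])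
  moreover have "(\<lambda>f x. \<Sum>j\<in>UNIV. w j *\<^sub>R - R_op j f x) = app (- R_vec_l w)"
    by (simp add: fun_eq_iff app_R_vec_l R_vec_def sum_negf)
  ultimately show ?thesis by simp
qed

lemma op_conj_R_vec: "op_conj (R_vec w) = app (- R_vec_l w)"
  by (rule op_conj_eq) (rule conj_graph_R_vec)

lemma op_prod_append: "op_prod (as @ bs) = op_prod as \<circ> op_prod bs"
  by (induction as) (auto simp: op_prod_def o_assoc)

lemma op_prod_Cons: "op_prod (a # as) = a \<circ> op_prod as"
  and op_prod_Nil: "op_prod [] = id"
  by (simp_all add: op_prod_def)

lemma conj_graph_op_prod:
  assumes "set ws \<subseteq> R1"
  shows "conj_graph (op_prod ws) (op_prod (map op_conj (rev ws)))"
  using assms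
proof (induction ws)
  case Nil
  show ?case unfolding list.map rev.simps op_prod_Nil by (rule conj_graph.intros(1))
next
  case (Cons w ws)
  then obtain u where "w = R_vec u" by (auto simp: R1_def)
  then have "conj_graph w (op_conj w)" by (simp add: op_conj_R_vec conj_graph_R_vec)
  then have "conj_graph (w \<circ> op_prod ws) (op_prod (map op_conj (rev ws)) \<circ> op_conj w)"
    using Cons by (intro conj_graph.intros(5)) auto
  then show ?case
    by (simp only: op_prod_append op_prod_Cons op_prod_Nil rev.simps map_append list.map comp_id)
qed

section \<open>Rotations\<close>

text \<open>The matrix identity M^T M = 1, summed over the first index because this is the sum that
  arises in the commutator of the rotated variables.\<close>

definition orthonormal_columns :: "('n::finite \<Rightarrow> 'n \<Rightarrow> real) \<Rightarrow> bool" where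
  "orthonormal_columns M \<longleftrightarrow> (\<forall>i j. (\<Sum>k\<in>UNIV. M k i * M k j) = (if i = j then 1 else 0))"

lemma orthonormal_columns_mult:
  assumes "orthonormal_columns H" "orthonormal_columns M"
  shows "orthonormal_columns (\<lambda>k j. \<Sum>l\<in>UNIV. H k l * M l j)"
  unfolding orthonormal_columns_def
proof (intro allI)
  fix i j
  have "(\<Sum>k\<in>UNIV. (\<Sum>l\<in>UNIV. H k l * M l i) * (\<Sum>l\<in>UNIV. H k l * M l j))
      = (\<Sum>k\<in>UNIV. \<Sum>l\<in>UNIV. \<Sum>l'\<in>UNIV. M l i * M l' j * (H k l * H k l'))"
    by (simp add: sum_product mult_ac)
  also have "\<dots> = (\<Sum>l\<in>UNIV. \<Sum>k\<in>UNIV. \<Sum>l'\<in>UNIV. M l i * M l' j * (H k l * H k l'))"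
    by (rule sum.swap)
  also have "\<dots> = (\<Sum>l\<in>UNIV. \<Sum>l'\<in>UNIV. \<Sum>k\<in>UNIV. M l i * M l' j * (H k l * H k l'))"
    by (intro sum.cong refl sum.swap)
  also have "\<dots> = (\<Sum>l\<in>UNIV. \<Sum>l'\<in>UNIV. M l i * M l' j * (if l = l' then 1 else 0))"
    using assms(1) by (simp add: orthonormal_columns_def flip: sum_distrib_left)
  also have "\<dots> = (\<Sum>l\<in>UNIV. M l i * M l j)"
    by (simp add: if_distrib[of "(*) _"] cong: if_cong)
  finally show "(\<Sum>k\<in>UNIV. (\<Sum>l\<in>UNIV. H k l * M l i) * (\<Sum>l\<in>UNIV. H k l * M l j))
      = (if i = j then 1 else 0)"
    using assms(2) by (simp add: orthonormal_columns_def)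
qed

text \<open>The Householder matrix 1 - 2 u u^T of a unit vector is symmetric and squares to
  1.\<close>

lemma orthonormal_columns_reflection:
  assumes "(\<Sum>k\<in>UNIV. u k * u k) = 1"
  shows "orthonormal_columns (\<lambda>k l. (if k = l then 1 else 0) - 2 * u k * u l)"
  unfolding orthonormal_columns_def
proof (intro allI)
  fix i j
  have "(\<Sum>k\<in>UNIV. ((if k = i then 1 else 0) - 2 * u k * u i) * ((if k = j then 1 else 0) - 2 * u k * u j))
    = (\<Sum>k\<in>UNIV. (if k = i then (if k = j then 1 else 0) else 0) - (if k = i then 2 * u k * u j else 0)
        - (if k = j then 2 * u k * u i else 0) + 4 * u i * u j * (u k * u k))"
    by (rule sum.cong) (auto simp: algebra_simps)
  also have "\<dots> = (if i = j then 1 else 0) - 2 * u i * u j - 2 * u j * u i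
      + 4 * u i * u j * (\<Sum>k\<in>UNIV. u k * u k)"
    by (simp add: sum.distrib sum_subtractf sum_distrib_left)
  finally show "(\<Sum>k\<in>UNIV. ((if k = i then 1 else 0) - 2 * u k * u i) * ((if k = j then 1 else 0) - 2 * u k * u j))
      = (if i = j then 1 else 0)"
    by (simp add: assms)
qed

lemma R_l_bracket: "R_l i * R_l j + R_l j * R_l i = (if i = j then 2 else 0) *\<^sub>R 1"
  by (simp add: R_l_square R_l_anticommute[of i j] scaleR_2)

lemma R_vec_l_bracket: "R_vec_l u * R_l k + R_l k * R_vec_l u = (2 * u k) *\<^sub>R 1"
proof -
  have "R_vec_l u * R_l k + R_l k * R_vec_l u = (\<Sum>j\<in>UNIV. u j *\<^sub>R (R_l j * R_l k + R_l k * R_l j))"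
    by (simp add: R_vec_l_def sum_distrib_left sum_distrib_right sum.distrib scaleR_right_distrib)
  also have "\<dots> = (\<Sum>j\<in>UNIV. if j = k then (2 * u k) *\<^sub>R 1 else 0)"
    unfolding R_l_bracket by (rule sum.cong) auto
  finally show ?thesis by simp
qed

lemma R_vec_l_square: "R_vec_l u * R_vec_l u = (\<Sum>k\<in>UNIV. u k * u k) *\<^sub>R 1"
proof -
  let ?V = "R_vec_l u"
  have "?V * ?V + ?V * ?V = (\<Sum>k\<in>UNIV. u k *\<^sub>R (?V * R_l k + R_l k * ?V))"
    \<comment> \<open>One factor of each product is expanded, on opposite sides, so that the sum
      consists of anticommutators of \<open>R_vec_l u\<close> with the \<open>R_l k\<close>.\<close>
    by (subst (2 3) R_vec_l_def)
       (simp add: sum_distrib_left sum_distrib_right sum.distrib scaleR_right_distrib)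
  also have "\<dots> = (2 * (\<Sum>k\<in>UNIV. u k * u k)) *\<^sub>R 1"
    unfolding R_vec_l_bracket by (simp add: scaleR_left.sum sum_distrib_left mult_ac)
  finally have "2 *\<^sub>R (?V * ?V) = 2 *\<^sub>R ((\<Sum>k\<in>UNIV. u k * u k) *\<^sub>R 1)"
    by (simp add: scaleR_2)
  then show ?thesis by (simp del: scaleR_scaleR)
qed

text \<open>The conjugate of \<open>R_vec_l u\<close> is its negative, so this is conjugation by a
  unit vector; it negates that vector and fixes its orthogonal complement.\<close>

lemma reflection:
  assumes "R_vec_l u * R_vec_l u = 1"
  shows "- R_vec_l u * R_l k * R_vec_l u
    = (\<Sum>l\<in>UNIV. ((if k = l then 1 else 0) - 2 * u k * u l) *\<^sub>R R_l l)"
proof -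
  let ?V = "R_vec_l u"
  have "?V * R_l k = (2 * u k) *\<^sub>R 1 - R_l k * ?V"
    using R_vec_l_bracket[of u k] by (simp add: algebra_simps)
  then have "- ?V * R_l k * ?V = R_l k - (2 * u k) *\<^sub>R ?V"
    by (simp add: left_diff_distrib mult.assoc assms)
  also have "\<dots> = (\<Sum>l\<in>UNIV. ((if k = l then 1 else 0) - 2 * u k * u l) *\<^sub>R R_l l)"
    by (simp add: scaleR_left_diff_distrib sum_subtractf R_vec_l_def scaleR_sum_right
        if_distrib[of "\<lambda>r. r *\<^sub>R _"] cong: if_cong)
  finally show ?thesis .
qed

lemma rotation:
  assumes "\<And>u. u \<in> set us \<Longrightarrow> R_vec_l u * R_vec_l u = 1"
  shows "\<exists>M. orthonormal_columns M \<and> (\<forall>k.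
    prod_list (map (\<lambda>u. - R_vec_l u) (rev us)) * R_l k * prod_list (map R_vec_l us)
      = (\<Sum>j\<in>UNIV. M k j *\<^sub>R R_l j))"
  using assms
proof (induction us)
  case Nil
  have id: "R_l k = (\<Sum>j\<in>UNIV. (if k = j then 1 else 0) *\<^sub>R R_l j)" for k :: 'a
    by (simp add: if_distrib[of "\<lambda>r. r *\<^sub>R _"] cong: if_cong)
  have "orthonormal_columns (\<lambda>k j :: 'a. if k = j then 1 else 0)"
    unfolding orthonormal_columns_def
  proof (intro allI)
    fix i j :: 'a
    have "(\<Sum>k\<in>UNIV. (if k = i then 1 else 0) * (if k = j then 1 else 0 :: real))
        = (\<Sum>k\<in>UNIV. if k = i then (if k = j then 1 else 0) else 0)"
      by (rule sum.cong) auto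
    then show "(\<Sum>k\<in>UNIV. (if k = i then 1 else 0) * (if k = j then 1 else 0 :: real))
        = (if i = j then 1 else 0)"
      by simp
  qed
  then show ?case
    by (intro exI[of _ "\<lambda>k j. if k = j then 1 else 0"] conjI allI)
       (simp_all only: rev.simps(1) list.map prod_list.Nil mult_1_left mult_1_right, rule id)
next
  case (Cons u us)
  then have V: "R_vec_l u * R_vec_l u = 1" by simp
  let ?S = "prod_list (map R_vec_l us)" and ?S' = "prod_list (map (\<lambda>u. - R_vec_l u) (rev us))"
  obtain M where M: "orthonormal_columns M" "\<And>k. ?S' * R_l k * ?S = (\<Sum>j\<in>UNIV. M k j *\<^sub>R R_l j)"
    using Cons by auto
  define H where "H = (\<lambda>k l. (if k = l then 1 else 0) - 2 * u k * u l)"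
  \<comment> \<open>The square of \<open>R_vec_l u\<close> is the squared length of \<open>u\<close>
    times the identity, and the identity is not 0.\<close>
  have "(\<Sum>k\<in>UNIV. u k * u k) = 1"
    using V unfolding R_vec_l_square by (metis scaleR_cancel_right scaleR_one zero_neq_one)
  then have "orthonormal_columns H" unfolding H_def by (rule orthonormal_columns_reflection)
  then have "orthonormal_columns (\<lambda>k j. \<Sum>l\<in>UNIV. H k l * M l j)"
    using M(1) by (rule orthonormal_columns_mult)
  moreover have "?S' * - R_vec_l u * R_l k * (R_vec_l u * ?S)
      = (\<Sum>j\<in>UNIV. (\<Sum>l\<in>UNIV. H k l * M l j) *\<^sub>R R_l j)" for k
  proof -
    have "?S' * - R_vec_l u * R_l k * (R_vec_l u * ?S) = ?S' * (- R_vec_l u * R_l k * R_vec_l u) * ?S"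
      by (simp only: mult.assoc)
    also have "\<dots> = (\<Sum>l\<in>UNIV. H k l *\<^sub>R (?S' * R_l l * ?S))"
      unfolding reflection[OF V] H_def by (simp add: sum_distrib_left sum_distrib_right)
    also have "\<dots> = (\<Sum>l\<in>UNIV. \<Sum>j\<in>UNIV. (H k l * M l j) *\<^sub>R R_l j)"
      by (simp add: M(2) scaleR_sum_right)
    also have "\<dots> = (\<Sum>j\<in>UNIV. \<Sum>l\<in>UNIV. (H k l * M l j) *\<^sub>R R_l j)"
      by (rule sum.swap)
    finally show ?thesis by (simp add: scaleR_left.sum)
  qed
  ultimately show ?case by (intro exI[of _ "\<lambda>k j. \<Sum>l\<in>UNIV. H k l * M l j"]) simp
qed

section \<open>The rotated variables and derivatives\<close>

definition Y_l :: "('n::{finite,linorder} \<Rightarrow> 'n \<Rightarrow> real) \<Rightarrow> 'n \<Rightarrow> 'n lop" where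
  "Y_l M j = (\<Sum>k\<in>UNIV. M k j *\<^sub>R X_l k)"
definition E_l :: "('n::{finite,linorder} \<Rightarrow> 'n \<Rightarrow> real) \<Rightarrow> 'n \<Rightarrow> 'n lop" where
  "E_l M j = (\<Sum>k\<in>UNIV. M k j *\<^sub>R D_l k)"

lemma R_l_Y_l: "R_l i * Y_l M j = Y_l M j * R_l i"
  by (simp add: Y_l_def sum_distrib_left sum_distrib_right R_l_X_l)

lemma R_l_E_l: "R_l i * E_l M j = E_l M j * R_l i"
  by (simp add: E_l_def sum_distrib_left sum_distrib_right R_l_D_l)

text \<open>The Weyl relations contribute \<Sum>_k M_ki M_kj, which is the (i, j) entry of M^T
  M.\<close>

lemma E_l_Y_l:
  assumes "orthonormal_columns M"
  shows "E_l M i * Y_l M j = Y_l M j * E_l M i + (if i = j then 1 else 0)"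
proof -
  have "E_l M i * Y_l M j = (\<Sum>k\<in>UNIV. \<Sum>l\<in>UNIV. (M k i * M l j) *\<^sub>R (D_l k * X_l l))"
    by (simp add: E_l_def Y_l_def sum_product mult_ac)
  also have "\<dots> = (\<Sum>k\<in>UNIV. \<Sum>l\<in>UNIV. (M k i * M l j) *\<^sub>R (X_l l * D_l k))
      + (\<Sum>k\<in>UNIV. \<Sum>l\<in>UNIV. (M k i * M l j) *\<^sub>R (if k = l then 1 else 0))"
    by (simp add: D_l_X_l scaleR_right_distrib sum.distrib)
  also have "(\<Sum>k\<in>UNIV. \<Sum>l\<in>UNIV. (M k i * M l j) *\<^sub>R (if k = l then 1 else 0 :: 'a lop))
      = (\<Sum>k\<in>UNIV. M k i * M k j) *\<^sub>R 1"
    by (simp add: if_distrib[of "scaleR _"] scaleR_left.sum cong: if_cong)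
  also have "(\<Sum>k\<in>UNIV. \<Sum>l\<in>UNIV. (M k i * M l j) *\<^sub>R (X_l l * D_l k))
      = (\<Sum>l\<in>UNIV. \<Sum>k\<in>UNIV. (M k i * M l j) *\<^sub>R (X_l l * D_l k))"
    by (rule sum.swap)
  also have "\<dots> = Y_l M j * E_l M i"
    by (simp add: E_l_def Y_l_def sum_product mult_ac)
  finally show ?thesis using assms by (simp add: orthonormal_columns_def)
qed

text \<open>\<open>Z_l M j\<close> turns out to be the component \<eta>_j of \<eta> = conj(s) \<xi>
  s, and \<open>P_l M j\<close> the corresponding summand of the conjugated Dirac operator.\<close>

definition Z_l :: "('n::{finite,linorder} \<Rightarrow> 'n \<Rightarrow> real) \<Rightarrow> 'n \<Rightarrow> 'n lop" where
  "Z_l M j = Y_l M j * R_l j"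
definition P_l :: "('n::{finite,linorder} \<Rightarrow> 'n \<Rightarrow> real) \<Rightarrow> 'n \<Rightarrow> 'n lop" where
  "P_l M j = E_l M j * R_l j"

text \<open>The parts \<open>E_l\<close> and \<open>Y_l\<close> commute with each other and with all
  \<open>R_l\<close>, so the sign comes from exchanging \<open>R_l i\<close> and
  \<open>R_l j\<close>.\<close>

lemma P_l_Z_l_anticommute:
  assumes "orthonormal_columns M" "i \<noteq> j"
  shows "P_l M i * Z_l M j = - (Z_l M j * P_l M i)"
proof -
  have "P_l M i * Z_l M j = E_l M i * Y_l M j * (R_l i * R_l j)"
    by (simp add: P_l_def Z_l_def mult.assoc commute_left[OF R_l_Y_l])
  also have "\<dots> = - (Y_l M j * E_l M i * (R_l j * R_l i))"
    by (simp add: E_l_Y_l[OF assms(1)] assms(2) R_l_anticommute[OF assms(2)])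
  also have "\<dots> = - (Z_l M j * P_l M i)"
    by (simp add: P_l_def Z_l_def mult.assoc commute_left[OF R_l_E_l])
  finally show ?thesis .
qed

lemma P_l_Z_l_same:
  assumes "orthonormal_columns M"
  shows "P_l M j * Z_l M j = Z_l M j * P_l M j + 1"
proof -
  have "P_l M j * Z_l M j = E_l M j * Y_l M j"
    by (simp add: P_l_def Z_l_def mult.assoc commute_left[OF R_l_Y_l] R_l_square)
  moreover have "Z_l M j * P_l M j = Y_l M j * E_l M j"
    by (simp add: P_l_def Z_l_def mult.assoc commute_left[OF R_l_E_l] R_l_square)
  ultimately show ?thesis by (simp add: E_l_Y_l[OF assms])
qed

lemma P_l_Z_l_power:
  assumes "orthonormal_columns M"
  shows "P_l M j * Z_l M j ^ n = Z_l M j ^ n * P_l M j + real n *\<^sub>R Z_l M j ^ (n - 1)"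
proof (induction n)
  case (Suc n)
  have "P_l M j * Z_l M j ^ Suc n = P_l M j * Z_l M j * Z_l M j ^ n"
    by (simp add: mult.assoc)
  also have "\<dots> = Z_l M j * (P_l M j * Z_l M j ^ n) + Z_l M j ^ n"
    by (simp add: P_l_Z_l_same[OF assms] distrib_right mult.assoc)
  also have "\<dots> = Z_l M j ^ Suc n * P_l M j + real n *\<^sub>R (Z_l M j * Z_l M j ^ (n - 1)) + Z_l M j ^ n"
    by (simp add: Suc distrib_left mult.assoc)
  also have "\<dots> = Z_l M j ^ Suc n * P_l M j + real (Suc n) *\<^sub>R Z_l M j ^ n"
    by (cases n) (simp_all add: scaleR_left_distrib scaleR_2 add.assoc)
  finally show ?case by simp
qed simp

lemma P_l_const: "app (P_l M j) (\<lambda>_. c) = (\<lambda>_. 0)"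
proof -
  have "app (partial_l k) (\<lambda>_. a) = (\<lambda>_. 0)" for k :: 'a and a
    using partial_l_basic_term[of k "\<lambda>_. 0" a] by (simp add: basic_term_0)
  then have "app (D_l k) (\<lambda>_. a) = (\<lambda>_. 0)" for k :: 'a and a
    by (simp add: D_l_def R_l_const)
  then show ?thesis
    by (simp add: fun_eq_iff P_l_def E_l_def R_l_const app_sum_left)
qed

definition Z_monomial :: "('n::{finite,linorder} \<Rightarrow> 'n \<Rightarrow> real) \<Rightarrow> 'n mindex \<Rightarrow> 'n dfun" where
  "Z_monomial M \<alpha> = app (prod_list (map (\<lambda>j. Z_l M j ^ \<alpha> j) (sorted_list_of_set UNIV))) (\<lambda>_. 1)"

lemma app_minus_one_power: "app ((- 1) ^ k * A) f x = ((- 1) ^ k :: real) *\<^sub>R app A f x"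
  by (simp add: minus_one_power_iff)

text \<open>The rule for \<open>partial j\<close> on \<xi>^\<alpha>[1] again, now derived from the
  relations of \<open>P_l\<close> and \<open>Z_l\<close> and from \<open>P_l_const\<close>: the sign
  comes from the factors before \<open>j\<close>, the multiplicity from the power with index
  \<open>j\<close>.\<close>

lemma P_l_Z_monomial:
  assumes "orthonormal_columns M"
  shows "app (P_l M j) (Z_monomial M \<alpha>)
    = (\<lambda>x. (sign {..<j} \<alpha> * real (\<alpha> j)) *\<^sub>R Z_monomial M (\<alpha>(j := \<alpha> j - 1)) x)"
proof
  fix x
  obtain as bs where split: "sorted_list_of_set UNIV = as @ j # bs" "set as = {..<j}"
    "set bs = {j<..}" "distinct as" "distinct bs"
    by (rule sorted_list_split)
  define A where "A = prod_list (map (\<lambda>i. Z_l M i ^ \<alpha> i) as)"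
  define B where "B = prod_list (map (\<lambda>i. Z_l M i ^ \<alpha> i) bs)"
  have cong_as: "map (\<lambda>i. Z_l M i ^ (\<alpha>(j := k)) i) as = map (\<lambda>i. Z_l M i ^ \<alpha> i) as"
    and cong_bs: "map (\<lambda>i. Z_l M i ^ (\<alpha>(j := k)) i) bs = map (\<lambda>i. Z_l M i ^ \<alpha> i) bs" for k
    using split by auto
  have Z: "Z_monomial M (\<alpha>(j := k)) = app (A * (Z_l M j ^ k * B)) (\<lambda>_. 1)" for k
    unfolding Z_monomial_def split map_append list.map prod_list.append prod_list.Cons cong_as cong_bs
    by (simp add: A_def B_def)
  have s: "sum_list (map \<alpha> as) = sum \<alpha> {..<j}"
    using split by (simp add: sum_list_distinct_conv_sum_set)
  have PA: "P_l M j * A = (- 1) ^ sum \<alpha> {..<j} * (A * P_l M j)"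
    unfolding A_def s[symmetric] using split
    by (intro anticommute_prod_list anticommute_power P_l_Z_l_anticommute assms) auto
  \<comment> \<open>What passes beyond index \<open>j\<close> arrives at the constant 1 and is
    annihilated, whatever the sign.\<close>
  have PB: "P_l M j * B = (- 1) ^ sum_list (map \<alpha> bs) * (B * P_l M j)"
    unfolding B_def using split
    by (intro anticommute_prod_list anticommute_power P_l_Z_l_anticommute assms) auto
  have "app (P_l M j * B) (\<lambda>_. 1) = (\<lambda>_. 0)"
    unfolding PB by (rule ext) (simp only: app_minus_one_power, simp add: P_l_const app_zero_right)
  then have PB1: "app (P_l M j) (app B (\<lambda>_. 1)) = (\<lambda>_. 0)" by simp
  have "P_l M j * (A * (Z_l M j ^ \<alpha> j * B)) = P_l M j * A * (Z_l M j ^ \<alpha> j * B)"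
    by (simp only: mult.assoc)
  also have "\<dots> = (- 1) ^ sum \<alpha> {..<j} * (A * (P_l M j * Z_l M j ^ \<alpha> j * B))"
    unfolding PA by (simp only: mult.assoc)
  also have "\<dots> = (- 1) ^ sum \<alpha> {..<j} * (A * (Z_l M j ^ \<alpha> j * (P_l M j * B))
      + real (\<alpha> j) *\<^sub>R (A * (Z_l M j ^ (\<alpha> j - 1) * B)))"
    by (simp add: P_l_Z_l_power[OF assms] distrib_left distrib_right mult.assoc)
  finally have "app (P_l M j) (Z_monomial M \<alpha>) x
    = app ((- 1) ^ sum \<alpha> {..<j} * (A * (Z_l M j ^ \<alpha> j * (P_l M j * B))
      + real (\<alpha> j) *\<^sub>R (A * (Z_l M j ^ (\<alpha> j - 1) * B)))) (\<lambda>_. 1) x"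
    using Z[of "\<alpha> j"] by (metis app_simps(6) fun_upd_triv)
  also have "\<dots> = (sign {..<j} \<alpha> * real (\<alpha> j)) *\<^sub>R Z_monomial M (\<alpha>(j := \<alpha> j - 1)) x"
    unfolding Z app_minus_one_power sign_def by (simp add: PB1 app_zero_right)
  finally show "app (P_l M j) (Z_monomial M \<alpha>) x
    = (sign {..<j} \<alpha> * real (\<alpha> j)) *\<^sub>R Z_monomial M (\<alpha>(j := \<alpha> j - 1)) x" .
qed

section \<open>Pointwise finiteness of the substituted series\<close>

lemma vanishes_add: "vanishes d f \<Longrightarrow> vanishes d g \<Longrightarrow> vanishes d (\<lambda>x. f x + g x)"
  by (induction d arbitrary: f g) (simp_all add: partial_add)

lemma vanishes_mult_right: "vanishes d f \<Longrightarrow> vanishes d (\<lambda>x. f x * c)"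
  by (induction d arbitrary: f) (simp_all add: partial_mult_right)

lemma vanishes_scaleR: "vanishes d f \<Longrightarrow> vanishes d (\<lambda>x. r *\<^sub>R f x)"
  using vanishes_mult_right[of d f "r *\<^sub>R 1"] by simp

text \<open>A degree for operators with respect to the order of vanishing at 0. As
  \<open>xi_l\<close> has degree 1 and \<open>R_l\<close> degree 0,
  \<open>Z_monomial M \<alpha>\<close> vanishes to order |\<alpha>|, as \<xi>^\<alpha>[1]
  does.\<close>

definition raises :: "nat \<Rightarrow> 'n::{finite,linorder} lop \<Rightarrow> bool" where
  "raises k L \<longleftrightarrow> (\<forall>d f. vanishes d f \<longrightarrow> vanishes (d + k) (app L f))"

lemma raises_one: "raises 0 1"
  by (simp add: raises_def)

lemma raises_mult: "raises k A \<Longrightarrow> raises l B \<Longrightarrow> raises (k + l) (A * B)"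
  unfolding raises_def by (simp, metis add.assoc add.commute)

lemma raises_scaleR: "raises k A \<Longrightarrow> raises k (r *\<^sub>R A)"
  unfolding raises_def by (metis (no_types, lifting) app_simps(7) ext vanishes_scaleR)

lemma raises_sum: "(\<And>i. i \<in> I \<Longrightarrow> raises k (A i)) \<Longrightarrow> raises k (\<Sum>i\<in>I. A i)"
proof (induction I rule: infinite_finite_induct)
  case (insert i I)
  have "app (A i + (\<Sum>i\<in>I. A i)) f = (\<lambda>x. app (A i) f x + app (\<Sum>i\<in>I. A i) f x)" for f
    by (simp add: fun_eq_iff)
  with insert show ?case by (simp add: raises_def vanishes_add)
next
  case empty
  have "app 0 f = (\<lambda>x. 0)" for f :: "'b dfun" by (simp add: fun_eq_iff)
  then show ?case by (simp add: raises_def vanishes_zero)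
next
  case (infinite I)
  have "app 0 f = (\<lambda>x. 0)" for f :: "'b dfun" by (simp add: fun_eq_iff)
  with infinite show ?case by (simp add: raises_def vanishes_zero)
qed

lemma raises_power: "raises k A \<Longrightarrow> raises (n * k) (A ^ n)"
  by (induction n) (simp_all add: raises_one raises_mult)

lemma raises_prod_list:
  "(\<And>i. i \<in> set l \<Longrightarrow> raises (k i) (A i)) \<Longrightarrow> raises (sum_list (map k l)) (prod_list (map A l))"
  by (induction l) (simp_all add: raises_one raises_mult)

lemma taylor_coeff_0: "taylor_coeff f (\<lambda>_. 0) = f (\<lambda>_. 0)"
  by (simp add: taylor_coeff_eq partial_at_0_def partial_power_0 mfact_def)

lemma R_l_at_0: "app (R_l j) f (\<lambda>_. 0) = e_vec j * f (\<lambda>_. 0)"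
proof -
  let ?T = "\<lambda>\<alpha> x. (- 1) ^ (\<Sum>i\<in>UNIV - {j}. \<alpha> i) * basic_poly \<alpha> x * e_vec j * taylor_coeff f \<alpha>"
  have "series ?T (\<lambda>_. 0) = (\<Sum>\<alpha>\<in>{\<lambda>_. 0}. ?T \<alpha> (\<lambda>_. 0))"
  proof (rule series_eq_sum)
    have "\<alpha> = (\<lambda>_. 0)" if "?T \<alpha> (\<lambda>_. 0) \<noteq> 0" for \<alpha>
      using that basic_poly_at_0[of \<alpha>] by (cases "\<alpha> = (\<lambda>_. 0)") auto
    then show "{\<alpha>. ?T \<alpha> (\<lambda>_. 0) \<noteq> 0} \<subseteq> {\<lambda>_. 0}" by blast
  qed simp
  then show ?thesis by (simp add: R_l.rep_eq R_op_def basic_poly_0 taylor_coeff_0)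
qed

lemma xi_l_at_0: "app (xi_l j) f (\<lambda>_. 0) = 0"
proof -
  let ?T = "\<lambda>\<alpha> x. (- 1) ^ (\<Sum>i<j. \<alpha> i) * basic_poly (\<alpha>(j := \<alpha> j + 1)) x * taylor_coeff f \<alpha>"
  have "\<alpha>(j := \<alpha> j + 1) \<noteq> (\<lambda>_. 0)" for \<alpha> :: "'a mindex"
    by (auto simp: fun_eq_iff intro: exI[of _ j])
  then have "series ?T (\<lambda>_. 0) = (\<Sum>\<alpha>\<in>{}. ?T \<alpha> (\<lambda>_. 0))"
    by (intro series_eq_sum) (auto simp: basic_poly_at_0)
  then show ?thesis by (simp add: xi_l.rep_eq xi_def)
qed

lemma vanishes_uminus: "vanishes d f \<Longrightarrow> vanishes d (\<lambda>x. - f x)"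
  using vanishes_scaleR[of d f "- 1"] by simp

lemma app_uminus_left: "app (- A) f = (\<lambda>x. - app A f x)"
  by (simp add: fun_eq_iff)

lemma raises_R_l: "raises 0 (R_l j)"
proof -
  have "vanishes d (app (R_l j) f)" if "vanishes d f" for d f
    using that
  proof (induction d arbitrary: f)
    case (Suc d)
    have "vanishes d (partial i (app (R_l j) f))" for i
    proof -
      have "partial i (app (R_l j) f) = app (partial_l i * R_l j) f"
        by (simp add: partial_l.rep_eq)
      also have "partial_l i * R_l j = (if j = i then R_l j * partial_l i else - (R_l j * partial_l i))"
        by (simp add: R_l_partial_l)
      finally have eq: "partial i (app (R_l j) f)
        = app (if j = i then R_l j * partial_l i else - (R_l j * partial_l i)) f" .
      have "vanishes d (app (R_l j) (partial i f))" using Suc by simp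
      then show ?thesis unfolding eq
        by (cases "j = i") (simp_all add: app_uminus_left partial_l.rep_eq vanishes_uminus)
    qed
    with Suc.prems show ?case by (simp add: R_l_at_0)
  qed simp
  then show ?thesis by (simp add: raises_def)
qed

text \<open>Derivatives pass \<open>xi_l j\<close> up to sign and, for index \<open>j\<close>, up to
  the extra summand \<open>f\<close>, which already has the order required of the
  derivative.\<close>

lemma raises_xi_l: "raises 1 (xi_l j)"
proof -
  have "vanishes (Suc d) (app (xi_l j) f)" if "vanishes d f" for d f
    using that
  proof (induction d arbitrary: f)
    case 0
    then show ?case by (simp add: xi_l_at_0)
  next
    case (Suc d)
    have "vanishes (Suc d) (partial i (app (xi_l j) f))" for i
    proof -
      have v: "vanishes (Suc d) (app (xi_l j) (partial i f))"
        using Suc by simp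
      have eq: "partial i (app (xi_l j) f) = app (partial_l i * xi_l j) f"
        by (simp add: partial_l.rep_eq)
      show ?thesis
      proof (cases "i = j")
        case True
        have "partial i (app (xi_l j) f) = (\<lambda>x. app (xi_l j) (partial i f) x + f x)"
          unfolding eq by (simp add: True partial_l_xi_l_same fun_eq_iff partial_l.rep_eq)
        then show ?thesis using vanishes_add[OF v Suc.prems] by simp
      next
        case False
        have "partial i (app (xi_l j) f) = (\<lambda>x. - app (xi_l j) (partial i f) x)"
          unfolding eq by (simp add: partial_l_xi_l[OF False] fun_eq_iff partial_l.rep_eq)
        then show ?thesis using vanishes_uminus[OF v] by simp
      qed
    qed
    then show ?case by (subst vanishes.simps(2)) (blast intro: xi_l_at_0)
  qed
  then show ?thesis by (simp add: raises_def)
qed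

lemma raises_Z_l: "raises 1 (Z_l M j)"
proof -
  have "raises 1 (X_l k * R_l j)" for k
    using raises_mult[OF raises_mult[OF raises_xi_l[of k] raises_R_l[of k]] raises_R_l[of j]]
    by (simp add: X_l_def)
  then have "raises 1 (\<Sum>k\<in>UNIV. M k j *\<^sub>R (X_l k * R_l j))"
    by (intro raises_sum raises_scaleR) simp
  then show ?thesis by (simp add: Z_l_def Y_l_def sum_distrib_right)
qed

lemma vanishes_Z_monomial: "vanishes (sum \<alpha> UNIV) (Z_monomial M \<alpha>)"
proof -
  have "sum_list (map \<alpha> (sorted_list_of_set UNIV)) = sum \<alpha> UNIV"
    by (simp add: sum_list_distinct_conv_sum_set)
  moreover have "raises (\<alpha> j) (Z_l M j ^ \<alpha> j)" for j
    using raises_power[OF raises_Z_l, of "\<alpha> j" M j] by simp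
  then have "raises (sum_list (map \<alpha> (sorted_list_of_set UNIV)))
     (prod_list (map (\<lambda>j. Z_l M j ^ \<alpha> j) (sorted_list_of_set UNIV)))"
    by (intro raises_prod_list)
  ultimately show ?thesis
    unfolding raises_def Z_monomial_def by (metis add_0 vanishes.simps(1))
qed

section \<open>Substitution and the Dirac operator\<close>

definition dirac_l :: "'n::{finite,linorder} lop" where
  "dirac_l = (\<Sum>j\<in>UNIV. partial_l j)"
definition xi_total_l :: "'n::{finite,linorder} lop" where
  "xi_total_l = (\<Sum>j\<in>UNIV. xi_l j)"

lemma app_dirac_l: "app dirac_l = dirac"
  by (simp add: fun_eq_iff dirac_l_def dirac_def app_sum_left partial_l.rep_eq)

lemma app_xi_total_l: "app xi_total_l = xi_total"
  by (simp add: fun_eq_iff xi_total_l_def xi_total_def app_sum_left xi_l.rep_eq)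

lift_definition subst_l :: "('n::{finite,linorder} \<Rightarrow> 'n \<Rightarrow> real) \<Rightarrow> 'n lop"
  is "\<lambda>M. taylor_op (Z_monomial M)"
  by (intro local_linear_taylor_op vanishes_finite vanishes_Z_monomial)

text \<open>\<open>P_l M j\<close> acts on the rotated monomials with the same coefficients and
  lowered indices as \<open>partial_l j\<close> on the basic ones.\<close>

lemma P_l_subst_l:
  assumes "orthonormal_columns M"
  shows "(\<Sum>j\<in>UNIV. P_l M j) * subst_l M = subst_l M * dirac_l"
proof (rule lop_eq_on_basic_term, rule ext)
  fix \<alpha> :: "'a mindex" and c x
  have subst: "app (subst_l M) (basic_term \<beta> a) = (\<lambda>x. Z_monomial M \<beta> x * a)" for \<beta> a
    by (simp add: subst_l.rep_eq taylor_op_basic_term)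
  have "app ((\<Sum>j\<in>UNIV. P_l M j) * subst_l M) (basic_term \<alpha> c) x
     = (\<Sum>j\<in>UNIV. app (P_l M j) (Z_monomial M \<alpha>) x * c)"
    by (simp add: subst app_sum_left app_mult_right sum_distrib_right)
  also have "\<dots> = (\<Sum>j\<in>UNIV. app (subst_l M * partial_l j) (basic_term \<alpha> c) x)"
    by (simp add: P_l_Z_monomial[OF assms] subst partial_l_basic_term)
  also have "\<dots> = app (subst_l M * dirac_l) (basic_term \<alpha> c) x"
    unfolding dirac_l_def sum_distrib_left by (simp only: app_sum_left)
  finally show "app ((\<Sum>j\<in>UNIV. P_l M j) * subst_l M) (basic_term \<alpha> c) x
     = app (subst_l M * dirac_l) (basic_term \<alpha> c) x" .
qed

lemma app_one: "app 1 = id"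
  by (simp add: fun_eq_iff)

lemma app_power: "app (A ^ n) = app A ^^ n"
  by (induction n) (simp_all only: power_0 power_Suc funpow.simps app_one app_times)

lemma app_prod_list: "app (prod_list l) = op_prod (map app l)"
  by (induction l) (simp_all only: prod_list.Nil prod_list.Cons list.map op_prod_Nil op_prod_Cons
      app_one app_times)

text \<open>The coefficients \<open>Y_l M i\<close> commute with \<open>R_l j\<close>, so the
  bracket with \<open>R_l j\<close> only sees the anticommutators of the \<open>R_l i\<close> and
  isolates \<open>Y_l M j\<close>.\<close>

lemma op_component_rotated:
  "op_component (app (\<Sum>i\<in>UNIV. Y_l M i * R_l i)) j = app (Z_l M j)"
proof -
  let ?\<eta> = "\<Sum>i\<in>UNIV. Y_l M i * R_l i"
  have "?\<eta> * R_l j + R_l j * ?\<eta> = (\<Sum>i\<in>UNIV. Y_l M i * (R_l i * R_l j + R_l j * R_l i))"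
    by (simp add: sum_distrib_left sum_distrib_right sum.distrib distrib_left mult.assoc
        commute_left[OF R_l_Y_l])
  also have "\<dots> = (\<Sum>i\<in>UNIV. if i = j then 2 *\<^sub>R Y_l M j else 0)"
    unfolding R_l_bracket by (rule sum.cong) auto
  finally have \<eta>: "(1 / 2) *\<^sub>R (?\<eta> * R_l j + R_l j * ?\<eta>) = Y_l M j" by simp
  have "op_component (app ?\<eta>) j = app ((1 / 2) *\<^sub>R (?\<eta> * R_l j + R_l j * ?\<eta>) * R_l j)"
    by (simp add: fun_eq_iff op_component_def op_bracket_def R_l.rep_eq)
  then show ?thesis unfolding \<eta> Z_l_def .
qed

lemma op_monomial_rotated:
  "op_monomial (app (\<Sum>i\<in>UNIV. Y_l M i * R_l i)) = Z_monomial M"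
  by (simp add: fun_eq_iff op_monomial_def Z_monomial_def op_component_rotated app_prod_list
      app_power o_def flip: app_power)

lemma op_subst_rotated:
  "op_subst f (app (\<Sum>i\<in>UNIV. Y_l M i * R_l i)) = app (subst_l M) f"
  by (simp add: op_subst_def op_monomial_rotated subst_l.rep_eq taylor_op_def)

section \<open>Spin elements and the conclusion\<close>

lemma unit_vector_lop:
  assumes "w \<in> unit_vectors"
  obtains u where "w = app (R_vec_l u)" "R_vec_l u * R_vec_l u = 1" "op_conj w = app (- R_vec_l u)"
proof -
  from assms obtain u where u: "w = R_vec u" and sq: "w \<circ> w = id"
    by (auto simp: unit_vectors_def R1_def)
  then have "app (R_vec_l u * R_vec_l u) = app 1"
    by (simp only: app_times app_one app_R_vec_l)
  then show thesis
    using u by (intro that[of u]) (simp_all only: app_R_vec_l op_conj_R_vec app_inject)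
qed

text \<open>The product telescopes from the middle: the inner part is a sign, and each surrounding
  pair \<open>v * - v\<close> contributes another factor -1.\<close>

lemma prod_list_square:
  fixes vs :: "'a::ring_1 list"
  assumes "\<And>v. v \<in> set vs \<Longrightarrow> v * v = 1"
  shows "prod_list vs * prod_list (map uminus (rev vs)) = (- 1) ^ length vs"
  using assms
proof (induction vs)
  case (Cons v vs)
  have "prod_list (v # vs) * prod_list (map uminus (rev (v # vs)))
      = v * (prod_list vs * prod_list (map uminus (rev vs))) * - v"
    by (simp add: mult.assoc)
  also have "\<dots> = (- 1) ^ length (v # vs)"
    using Cons by (simp add: minus_one_power_iff)
  finally show ?case .
qed simp

theorem corollary3:
  fixes s :: "'n::{finite,linorder} dop" and ws :: "'n dop list" and k :: nat and f :: "'n dfun"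
  assumes "s \<in> Spin"
    and "set ws \<subseteq> unit_vectors" and "length ws = 2 * k" and "s = op_prod ws"
    and "dirac f = (\<lambda>_. 0)"
  shows "dirac (s (op_subst f (op_conj s \<circ> xi_total \<circ> s))) =
           dirac (op_prod ws (op_subst f
             (op_prod (map op_conj (rev ws)) \<circ> xi_total \<circ> op_prod ws))) \<and>
         dirac (op_prod ws (op_subst f
             (op_prod (map op_conj (rev ws)) \<circ> xi_total \<circ> op_prod ws))) = (\<lambda>_. 0)"
proof -
  have "set ws \<subseteq> R1" using assms(2) by (auto simp: unit_vectors_def)
  then have conj: "op_conj s = op_prod (map op_conj (rev ws))"
    unfolding assms(4) by (intro op_conj_eq conj_graph_op_prod)
  have "\<forall>w\<in>set ws. \<exists>u. w = app (R_vec_l u) \<and> R_vec_l u * R_vec_l u = 1 \<and> op_conj w = app (- R_vec_l u)"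
    using assms(2) unit_vector_lop by (metis subsetD)
  then obtain U where U: "\<And>w. w \<in> set ws \<Longrightarrow> w = app (R_vec_l (U w))"
    "\<And>w. w \<in> set ws \<Longrightarrow> R_vec_l (U w) * R_vec_l (U w) = 1"
    "\<And>w. w \<in> set ws \<Longrightarrow> op_conj w = app (- R_vec_l (U w))"
    by metis
  define us where "us = map U ws"
  have sq: "R_vec_l u * R_vec_l u = 1" if "u \<in> set us" for u
    using that U(2) by (auto simp: us_def)
  define S where "S = prod_list (map R_vec_l us)"
  define S' where "S' = prod_list (map (\<lambda>u. - R_vec_l u) (rev us))"
  have "map (app \<circ> R_vec_l) us = ws"
    using U(1) by (auto simp: us_def intro!: map_idI)
  then have S: "op_prod ws = app S" by (simp add: S_def app_prod_list)
  have "map app (map (\<lambda>u. - R_vec_l u) (rev us)) = map op_conj (rev ws)"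
    using U(3) by (simp add: us_def rev_map)
  then have S': "op_prod (map op_conj (rev ws)) = app S'" by (simp add: S'_def app_prod_list)
  have "S * S' = (- 1) ^ length us"
    using prod_list_square[of "map R_vec_l us"] sq by (auto simp: S_def S'_def rev_map o_def)
  \<comment> \<open>The number of factors is even, so the conjugate is a right inverse of s.\<close>
  then have SS': "S * S' = 1" using assms(3) by (simp add: us_def)
  obtain M where M: "orthonormal_columns M" "\<And>k. S' * R_l k * S = (\<Sum>j\<in>UNIV. M k j *\<^sub>R R_l j)"
    using rotation[OF sq] unfolding S_def S'_def by blast
  have commute: "S' * A = A * S'" if "\<And>j. R_l j * A = A * R_l j" for A
  proof -
    have V: "- R_vec_l u * A = A * - R_vec_l u" for u
      using that by (simp add: R_vec_l_def sum_distrib_left sum_distrib_right)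
    have "prod_list (map (\<lambda>u. - R_vec_l u) us) * A = A * prod_list (map (\<lambda>u. - R_vec_l u) us)" for us
      by (induction us) (simp_all only: list.map prod_list.Nil prod_list.Cons mult_1_left mult_1_right
          mult.assoc commute_left[OF V])
    then show ?thesis by (simp only: S'_def)
  qed
  \<comment> \<open>Coefficients commuting with all \<open>R_l j\<close> pass through
    \<open>S'\<close>, so the conjugation meets only the \<open>R_l k\<close>; exchanging the sums
    transfers the matrix to the coefficients. Applied to \<open>X_l\<close> and \<open>D_l\<close>
    this gives both conjugated operators with the same matrix.\<close>
  have rotate: "S' * (\<Sum>k\<in>UNIV. A k * R_l k) * S = (\<Sum>j\<in>UNIV. (\<Sum>k\<in>UNIV. M k j *\<^sub>R A k) * R_l j)"
    if "\<And>j k. R_l j * A k = A k * R_l j" for A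
  proof -
    have "S' * (\<Sum>k\<in>UNIV. A k * R_l k) * S = (\<Sum>k\<in>UNIV. A k * (S' * R_l k * S))"
      using commute_left[OF commute, OF that]
      by (simp add: sum_distrib_left sum_distrib_right mult.assoc)
    also have "\<dots> = (\<Sum>k\<in>UNIV. \<Sum>j\<in>UNIV. M k j *\<^sub>R A k * R_l j)"
      by (simp add: M(2) sum_distrib_left)
    also have "\<dots> = (\<Sum>j\<in>UNIV. \<Sum>k\<in>UNIV. M k j *\<^sub>R A k * R_l j)"
      by (rule sum.swap)
    finally show ?thesis by (simp only: sum_distrib_right)
  qed
  have xi: "S' * xi_total_l * S = (\<Sum>j\<in>UNIV. Y_l M j * R_l j)"
    unfolding xi_total_l_def xi_l_eq Y_l_def by (rule rotate) (rule R_l_X_l)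
  have dirac: "S' * dirac_l * S = (\<Sum>j\<in>UNIV. P_l M j)"
    unfolding dirac_l_def partial_l_eq P_l_def E_l_def by (rule rotate) (rule R_l_D_l)
  have "app S' \<circ> xi_total \<circ> app S = app (S' * xi_total_l * S)"
    by (simp add: fun_eq_iff app_xi_total_l)
  then have subst: "op_subst f (app S' \<circ> xi_total \<circ> app S) = app (subst_l M) f"
    by (simp only: xi op_subst_rotated)
  \<comment> \<open>Inserting \<open>S * S' = 1\<close> on the left exposes
    \<open>S' * dirac_l * S\<close>, which the substitution turns into \<open>dirac_l\<close> acting
    directly on \<open>f\<close>.\<close>
  have "dirac_l * S * subst_l M = S * S' * (dirac_l * S * subst_l M)"
    by (simp add: SS')
  also have "\<dots> = S * ((S' * dirac_l * S) * subst_l M)"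
    by (simp only: mult.assoc)
  also have "\<dots> = S * (subst_l M * dirac_l)"
    by (simp only: dirac P_l_subst_l[OF M(1)])
  also have "\<dots> = S * subst_l M * dirac_l"
    by (simp only: mult.assoc)
  finally have "app (dirac_l * S * subst_l M) f = app (S * subst_l M * dirac_l) f" by simp
  then have "dirac (app S (app (subst_l M) f)) = (\<lambda>_. 0)"
    by (simp add: app_dirac_l assms(5) app_zero_right)
  then have "dirac (op_prod ws (op_subst f
      (op_prod (map op_conj (rev ws)) \<circ> xi_total \<circ> op_prod ws))) = (\<lambda>_. 0)"
    unfolding S S' subst .
  then show ?thesis using conj assms(4) by simp
qed

end
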